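(* \begin{enumerate} \item The linear map $P_{chr}:\mathcal{H}_{\mathcal{G}}\to\mathbb{Q}[X]$ sending each graph to its chromatic polynomial is the unique map $\phi_1:\mathcal{H}_{\mathcal{G}}\to\mathbb{Q}[X]$ which is both a Hopf algebra morphism from $(\mathcal{H}_{\mathcal{G}},m,\Delta)$ to $(\mathbb{Q}[X],m,\Delta)$ and a bialgebra morphism from $(\mathcal{H}_{\mathcal{G}},m,\delta)$ to $(\mathbb{Q}[X],m,\delta)$. \item Let $(\mathcal{D},+)$ be a nonempty abelian semigroup. The unique map $\phi_1^{(\mathcal{D})}:\mathcal{H}_{\mathcal{G}(\mathcal{D})}\to\mathbb{Q}[X]$ which is both a Hopf algebra morphism from $(\mathcal{H}_{\mathcal{G}(\mathcal{D})},m,\Delta)$ to $(\mathbb{Q}[X],m,\Delta)$ and a bialgebra morphism from $(\mathcal{H}_{\mathcal{G}(\mathcal{D})},m,\delta)$ to $(\mathbb{Q}[X],m,\delta)$ is $P_{chr}^{(\mathcal{D})}=P_{chr}\circ\mathcal{F}^{(\mathcal{D})}$, where $\mathcal{F}^{(\mathcal{D})}:\mathcal{H}_{\mathcal{G}(\mathcal{D})}\to\mathcal{H}_{\mathcal{G}}$ is the linear map forgetting the decorations. \end{enumerate}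
   Context: A graph is a pair $G=(V(G),E(G))$ with $V(G)$ a finite set and $E(G)$ a set of $2$-element subsets of $V(G)$; graphs are considered up to isomorphism. The empty graph is denoted $1$ and is considered as non connected. For any graph $G$ and $k\geq1$, $P_{chr}(G)(k)$ is the number of maps $f:V(G)\to\{1,\ldots,k\}$ such that $f(x)\neq f(y)$ for every edge $\{x,y\}$ of $G$; this defines a unique polynomial $P_{chr}(G)\in\mathbb{Q}[X]$, the chromatic polynomial. For $I\subseteq V(G)$, $G_{|I}$ is the induced subgraph on $I$. For an equivalence relation $\sim$ on $V(G)$: $G/\sim$ is the graph with vertex set $V(G)/\sim$ and with an edge between two distinct classes if and only if some edge of $G$ joins an element of one to an element of the other; $G|\sim$ is the graph with $V(G|\sim)=V(G)$ and $E(G|\sim)=\{\{x,y\}\in E(G): x\sim y\}$; one writes $\sim\triangleleft G$ if $G_{|c}$ is connected for every class $c$ of $\sim$. A $\mathcal{D}$-decorated graph is a pair $(G,d_G)$ with $G$ a graph and $d_G:V(G)\to\mathcal{D}$ a map; isomorphisms preserve decorations. Disjoint unions and induced subgraphs are decorated by restriction; $G|\sim$ is decorated by $d_G$; $G/\sim$ is decorated by $d_{G/\sim}(c)=\sum_{x\in c}d_G(x)$. $\mathcal{H}_{\mathcal{G}}$ (resp. $\mathcal{H}_{\mathcal{G}(\mathcal{D})}$) is the $\mathbb{Q}$-vector space with basis the isoclasses of graphs (resp. of $\mathcal{D}$-decorated graphs), with product $m$ given by disjoint union, and coproducts $$\Delta(G)=\sum_{V(G)=I\sqcup J}G_{|I}\otimes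 G_{|J},\qquad \delta(G)=\sum_{\sim\triangleleft G}(G/\sim)\otimes(G|\sim).$$ In both cases $(\cdot,m,\Delta)$ is a Hopf algebra, whose counit $\varepsilon$ sends the empty graph to $1$ and nonempty graphs to $0$, and $(\cdot,m,\delta)$ is a bialgebra, whose counit $\varepsilon'$ sends graphs without edges to $1$ and the others to $0$. On $\mathbb{Q}[X]$, $m$ is the usual product, and $\Delta$, $\delta$ are the algebra morphisms with $\Delta(X)=X\otimes1+1\otimes X$ and $\delta(X)=X\otimes X$; their counits are $\varepsilon(P)=P(0)$ and $\varepsilon'(P)=P(1)$ respectively. Bialgebra morphisms preserve units and counits. *)

theory Defs
  imports
    "HOL-Library.Poly_Mapping"
    "HOL-Library.FuncSet"
    "HOL-Computational_Algebra.Polynomial"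
begin

section \<open>Finite graphs\<close>

type_synonym 'v graph = "'v set \<times> 'v set set"

abbreviation verts :: "'v graph \<Rightarrow> 'v set" where "verts \<equiv> fst"
abbreviation edges :: "'v graph \<Rightarrow> 'v set set" where "edges \<equiv> snd"

definition is_graph :: "'v graph \<Rightarrow> bool" where
  "is_graph G \<longleftrightarrow> finite (verts G) \<and> (\<forall>e\<in>edges G. e \<subseteq> verts G \<and> card e = 2)"

definition graph_iso :: "('v \<Rightarrow> 'w) \<Rightarrow> 'v graph \<Rightarrow> 'w graph \<Rightarrow> bool" where
  "graph_iso f G H \<longleftrightarrow> bij_betw f (verts G) (verts H) \<and> edges H = (\<lambda>e. f ` e) ` edges G"

definition isomorphic :: "'v graph \<Rightarrow> 'w graph \<Rightarrow> bool" where
  "isomorphic G H \<longleftrightarrow> (\<exists>f. graph_iso f G H)"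

definition empty_graph :: "'v graph" where
  "empty_graph = ({}, {})"

definition disjoint_union :: "'v graph \<Rightarrow> 'w graph \<Rightarrow> ('v + 'w) graph" where
  "disjoint_union G H =
     (verts G <+> verts H, (\<lambda>e. Inl ` e) ` edges G \<union> (\<lambda>e. Inr ` e) ` edges H)"

definition induced :: "'v graph \<Rightarrow> 'v set \<Rightarrow> 'v graph" where
  "induced G I = (I, {e \<in> edges G. e \<subseteq> I})"

text \<open>The empty graph is not connected.\<close>

definition connected_graph :: "'v graph \<Rightarrow> bool" where
  "connected_graph G \<longleftrightarrow>
     verts G \<noteq> {} \<and> (\<forall>x\<in>verts G. \<forall>y\<in>verts G. (x, y) \<in> {(u, v). {u, v} \<in> edges G}\<^sup>*)"

text \<open>\<open>contract_graph G r\<close> is $G/{\sim}$ and \<open>restrict_graph G r\<close> is $G|{\sim}$.\<close>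

definition contract_graph :: "'v graph \<Rightarrow> ('v \<times> 'v) set \<Rightarrow> 'v set graph" where
  "contract_graph G r =
     (verts G // r,
      {{c, c'} | c c'. c \<in> verts G // r \<and> c' \<in> verts G // r \<and> c \<noteq> c' \<and>
         (\<exists>x\<in>c. \<exists>y\<in>c'. {x, y} \<in> edges G)})"

definition restrict_graph :: "'v graph \<Rightarrow> ('v \<times> 'v) set \<Rightarrow> 'v graph" where
  "restrict_graph G r = (verts G, {{x, y} | x y. {x, y} \<in> edges G \<and> (x, y) \<in> r})"

text \<open>The relations $\sim\triangleleft G$.\<close>

definition contractions :: "'v graph \<Rightarrow> ('v \<times> 'v) set set" where
  "contractions G =
     {r. equiv (verts G) r \<and> (\<forall>c \<in> verts G // r. connected_graph (induced G c))}"

definition proper_colourings :: "'v graph \<Rightarrow> nat \<Rightarrow> ('v \<Rightarrow> nat) set" where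
  "proper_colourings G k =
     {f \<in> verts G \<rightarrow>\<^sub>E {1..k}. \<forall>x y. {x, y} \<in> edges G \<longrightarrow> f x \<noteq> f y}"

definition chromatic_polynomial :: "'v graph \<Rightarrow> rat poly" where
  "chromatic_polynomial G =
     (THE P. \<forall>k\<ge>1. poly P (of_nat k) = of_nat (card (proper_colourings G k)))"


section \<open>Decorated graphs\<close>

text \<open>Only the values of the decoration on the vertices matter.\<close>

type_synonym ('v, 'd) dgraph = "'v graph \<times> ('v \<Rightarrow> 'd)"

definition dgraph_iso :: "('v \<Rightarrow> 'w) \<Rightarrow> ('v, 'd) dgraph \<Rightarrow> ('w, 'd) dgraph \<Rightarrow> bool" where
  "dgraph_iso f G H \<longleftrightarrow>
     graph_iso f (fst G) (fst H) \<and> (\<forall>x\<in>verts (fst G). snd H (f x) = snd G x)"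

definition disomorphic :: "('v, 'd) dgraph \<Rightarrow> ('w, 'd) dgraph \<Rightarrow> bool" where
  "disomorphic G H \<longleftrightarrow> (\<exists>f. dgraph_iso f G H)"

definition empty_dgraph :: "('v, 'd) dgraph" where
  "empty_dgraph = (empty_graph, \<lambda>_. undefined)"

definition ddisjoint_union ::
    "('v, 'd) dgraph \<Rightarrow> ('w, 'd) dgraph \<Rightarrow> ('v + 'w, 'd) dgraph" where
  "ddisjoint_union G H = (disjoint_union (fst G) (fst H), case_sum (snd G) (snd H))"

definition dinduced :: "('v, 'd) dgraph \<Rightarrow> 'v set \<Rightarrow> ('v, 'd) dgraph" where
  "dinduced G I = (induced (fst G) I, snd G)"

text \<open>
  The sum of a nonempty finite family in a commutative semigroup, which need not have a zero,
  so that \<open>sum\<close> is not available. The result does not depend on the chosen starting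
  point: see \<open>semigroup_sum_insert\<close> below.
\<close>

definition semigroup_sum :: "('v \<Rightarrow> 'd::ab_semigroup_add) \<Rightarrow> 'v set \<Rightarrow> 'd" where
  "semigroup_sum d A =
     (let a = SOME a. a \<in> A in Finite_Set.fold (\<lambda>x s. d x + s) (d a) (A - {a}))"

definition dcontract ::
    "('v, 'd::ab_semigroup_add) dgraph \<Rightarrow> ('v \<times> 'v) set \<Rightarrow> ('v set, 'd) dgraph" where
  "dcontract G r = (contract_graph (fst G) r, semigroup_sum (snd G))"

definition drestrict :: "('v, 'd) dgraph \<Rightarrow> ('v \<times> 'v) set \<Rightarrow> ('v, 'd) dgraph" where
  "drestrict G r = (restrict_graph (fst G) r, snd G)"

lemma semigroup_sum_fold:
  assumes "finite A" "a \<in> A"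
  shows "semigroup_sum d A = Finite_Set.fold (\<lambda>x s. d x + s) (d a) (A - {a})"
proof -
  interpret comp_fun_commute_on UNIV "\<lambda>x s. d x + s"
    by unfold_locales (simp add: fun_eq_iff add.left_commute)
  have *: "Finite_Set.fold (\<lambda>x s. d x + s) (d a) (A - {a}) =
           Finite_Set.fold (\<lambda>x s. d x + s) (d b) (A - {b})"
    if "a \<in> A" "b \<in> A" "a \<noteq> b" for a b
  proof -
    let ?B = "A - {a} - {b}"
    have fin: "finite ?B" using assms by simp
    have A: "A - {a} = insert b ?B" "A - {b} = insert a ?B" using that by auto
    have sw: "Finite_Set.fold (\<lambda>x s. d x + s) (t + u) B = t + Finite_Set.fold (\<lambda>x s. d x + s) u B"
      if "finite B" for t u B
      using that by (induction B) (auto simp: fold_insert add.left_commute)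
    have "Finite_Set.fold (\<lambda>x s. d x + s) (d a) (insert b ?B) =
        d b + Finite_Set.fold (\<lambda>x s. d x + s) (d a) ?B"
      using fin by (intro fold_insert) auto
    also have "\<dots> = Finite_Set.fold (\<lambda>x s. d x + s) (d b + d a) ?B" by (rule sw[OF fin, symmetric])
    also have "\<dots> = Finite_Set.fold (\<lambda>x s. d x + s) (d a + d b) ?B" by (simp only: add.commute)
    also have "\<dots> = d a + Finite_Set.fold (\<lambda>x s. d x + s) (d b) ?B" by (rule sw[OF fin])
    also have "\<dots> = Finite_Set.fold (\<lambda>x s. d x + s) (d b) (insert a ?B)"
      using fin that by (intro fold_insert[symmetric]) auto
    finally have "Finite_Set.fold (\<lambda>x s. d x + s) (d a) (insert b ?B) =
        Finite_Set.fold (\<lambda>x s. d x + s) (d b) (insert a ?B)" .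
    then show ?thesis by (simp only: A[symmetric])
  qed
  have "(SOME a. a \<in> A) \<in> A" using assms(2) by (rule someI)
  then show ?thesis unfolding semigroup_sum_def Let_def using *[OF _ assms(2)] by metis
qed

lemma semigroup_sum_singleton: "semigroup_sum d {x} = d x"
  by (subst semigroup_sum_fold[of _ x]) auto

lemma semigroup_sum_insert:
  assumes "finite A" "A \<noteq> {}" "x \<notin> A"
  shows "semigroup_sum d (insert x A) = d x + semigroup_sum d A"
proof -
  interpret comp_fun_commute_on UNIV "\<lambda>x s. d x + s"
    by unfold_locales (simp add: fun_eq_iff add.left_commute)
  obtain a where a: "a \<in> A" using assms by auto
  have "semigroup_sum d (insert x A) = Finite_Set.fold (\<lambda>x s. d x + s) (d a) (insert x A - {a})"
    using a assms by (intro semigroup_sum_fold) auto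
  also have "insert x A - {a} = insert x (A - {a})" using a assms by auto
  also have "Finite_Set.fold (\<lambda>x s. d x + s) (d a) (insert x (A - {a})) =
      d x + Finite_Set.fold (\<lambda>x s. d x + s) (d a) (A - {a})"
    using assms by (subst fold_insert) auto
  also have "\<dots> = d x + semigroup_sum d A"
    using a assms by (subst semigroup_sum_fold[of _ a]) auto
  finally show ?thesis .
qed

lemma semigroup_sum_eq_sum:
  fixes d :: "'v \<Rightarrow> 'd::comm_monoid_add"
  assumes "finite A" "A \<noteq> {}"
  shows "semigroup_sum d A = sum d A"
  using assms
  by (induction rule: finite_ne_induct)
     (auto simp: semigroup_sum_singleton semigroup_sum_insert)

lemma semigroup_sum_image:
  assumes "finite A" "A \<noteq> {}" "inj_on f A" "\<And>x. x \<in> A \<Longrightarrow> d' (f x) = d x"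
  shows "semigroup_sum d' (f ` A) = semigroup_sum d A"
  using assms
proof (induction rule: finite_ne_induct)
  case (singleton x)
  then show ?case by (simp add: semigroup_sum_singleton)
next
  case (insert x F)
  then have "f x \<notin> f ` F" by auto
  with insert show ?case by (simp add: semigroup_sum_insert)
qed


section \<open>Basic facts on isomorphisms\<close>

lemma is_graph_edgeE:
  assumes "is_graph G" "e \<in> edges G"
  obtains x y where "e = {x, y}" "x \<noteq> y" "x \<in> verts G" "y \<in> verts G"
  using assms unfolding is_graph_def by (metis card_2_iff insert_subset)

lemma graph_iso_edge_iff:
  assumes "is_graph G" "graph_iso f G H" "x \<in> verts G" "y \<in> verts G"
  shows "{f x, f y} \<in> edges H \<longleftrightarrow> {x, y} \<in> edges G"
proof
  assume "{f x, f y} \<in> edges H"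
  then obtain e where e: "e \<in> edges G" "{f x, f y} = f ` e"
    using assms(2) unfolding graph_iso_def by auto
  have "e \<subseteq> verts G" using assms(1) e unfolding is_graph_def by auto
  moreover have "inj_on f (verts G)" using assms(2) unfolding graph_iso_def bij_betw_def by auto
  moreover have "f ` {x, y} = f ` e" using e by simp
  ultimately have "{x, y} = e" using assms(3,4) inj_on_image_eq_iff[of f "verts G" "{x, y}" e] by auto
  then show "{x, y} \<in> edges G" using e by simp
next
  assume "{x, y} \<in> edges G"
  then have "f ` {x, y} \<in> edges H" using assms(2) unfolding graph_iso_def by blast
  then show "{f x, f y} \<in> edges H" by simp
qed

lemma dgraph_iso_imp_graph_iso: "dgraph_iso f G H \<Longrightarrow> graph_iso f (fst G) (fst H)"
  by (simp add: dgraph_iso_def)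

lemma dgraph_iso_id: "dgraph_iso id G G"
  by (simp add: dgraph_iso_def graph_iso_def)

lemma dgraph_iso_comp:
  "dgraph_iso f G H \<Longrightarrow> dgraph_iso g H K \<Longrightarrow> dgraph_iso (g \<circ> f) G K"
  unfolding dgraph_iso_def graph_iso_def
  by (auto simp: image_comp image_image intro: bij_betw_trans dest: bij_betwE)

lemma dgraph_iso_inv:
  assumes "is_graph (fst G)" "dgraph_iso f G H"
  shows "dgraph_iso (inv_into (verts (fst G)) f) H G"
proof -
  let ?g = "inv_into (verts (fst G)) f"
  have f: "bij_betw f (verts (fst G)) (verts (fst H))"
    and E: "edges (fst H) = (\<lambda>e. f ` e) ` edges (fst G)"
    and d: "\<forall>x\<in>verts (fst G). snd H (f x) = snd G x"
    using assms unfolding dgraph_iso_def graph_iso_def by auto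
  have inj: "inj_on f (verts (fst G))" using f by (simp add: bij_betw_def)
  have "?g ` f ` e = e" if "e \<in> edges (fst G)" for e
  proof -
    have "e \<subseteq> verts (fst G)" using that assms(1) unfolding is_graph_def by auto
    then show ?thesis using inj by simp
  qed
  then have "(\<lambda>e. ?g ` e) ` edges (fst H) = edges (fst G)"
    unfolding E image_image by simp
  moreover have "snd G (?g y) = snd H y" if "y \<in> verts (fst H)" for y
    using d f that by (metis bij_betw_imp_surj_on f_inv_into_f inv_into_into)
  ultimately show ?thesis
    unfolding dgraph_iso_def graph_iso_def using bij_betw_inv_into[OF f] by simp
qed

lemma disomorphic_refl: "disomorphic G G"
  unfolding disomorphic_def using dgraph_iso_id by blast

lemma disomorphic_sym: "is_graph (fst G) \<Longrightarrow> disomorphic G H \<Longrightarrow> disomorphic H G"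
  unfolding disomorphic_def using dgraph_iso_inv by blast

lemma disomorphic_trans: "disomorphic G H \<Longrightarrow> disomorphic H K \<Longrightarrow> disomorphic G K"
  unfolding disomorphic_def using dgraph_iso_comp by blast

lemma disomorphic_cong:
  assumes "is_graph (fst G)" "disomorphic G H"
  shows "disomorphic G K \<longleftrightarrow> disomorphic H K"
  using disomorphic_trans[OF disomorphic_sym[OF assms]] disomorphic_trans[OF assms(2)] by (rule iffI)

lemma isomorphic_iff_unit: "isomorphic G H \<longleftrightarrow> disomorphic (G, \<lambda>_. ()) (H, \<lambda>_. ())"
  unfolding isomorphic_def disomorphic_def dgraph_iso_def by simp

lemma isomorphic_refl: "isomorphic G G"
  by (simp add: isomorphic_iff_unit disomorphic_refl)

lemma isomorphic_sym: "is_graph G \<Longrightarrow> isomorphic G H \<Longrightarrow> isomorphic H G"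
  unfolding isomorphic_iff_unit by (rule disomorphic_sym) auto

lemma isomorphic_trans: "isomorphic G H \<Longrightarrow> isomorphic H K \<Longrightarrow> isomorphic G K"
  unfolding isomorphic_iff_unit by (rule disomorphic_trans)

lemma isomorphic_cong:
  assumes "is_graph G" "isomorphic G H"
  shows "isomorphic G K \<longleftrightarrow> isomorphic H K"
  using isomorphic_trans[OF isomorphic_sym[OF assms]] isomorphic_trans[OF assms(2)] by (rule iffI)

lemma is_graph_image:
  assumes "is_graph G" "inj_on f (verts G)"
  shows "is_graph (f ` verts G, (\<lambda>e. f ` e) ` edges G)"
    and "graph_iso f G (f ` verts G, (\<lambda>e. f ` e) ` edges G)"
proof -
  have "card (f ` e) = 2" if "e \<in> edges G" for e
  proof -
    have "e \<subseteq> verts G" "card e = 2" using that assms unfolding is_graph_def by auto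
    then show ?thesis using assms(2) by (metis card_image inj_on_subset)
  qed
  moreover have "f ` e \<subseteq> f ` verts G" if "e \<in> edges G" for e
    using that assms unfolding is_graph_def by auto
  ultimately show "is_graph (f ` verts G, (\<lambda>e. f ` e) ` edges G)"
    using assms(1) unfolding is_graph_def by auto
  show "graph_iso f G (f ` verts G, (\<lambda>e. f ` e) ` edges G)"
    unfolding graph_iso_def using assms(2) by (simp add: bij_betw_def)
qed

lemma ex_nat_dgraph:
  assumes "is_graph (fst (G :: ('v, 'd) dgraph))"
  shows "\<exists>H :: (nat, 'd) dgraph. is_graph (fst H) \<and> disomorphic G H"
proof -
  have "finite (verts (fst G))" using assms by (simp add: is_graph_def)
  then obtain f :: "'v \<Rightarrow> nat" where f: "inj_on f (verts (fst G))"
    using finite_imp_inj_to_nat_seg by blast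
  let ?H = "((f ` verts (fst G), (\<lambda>e. f ` e) ` edges (fst G)),
             \<lambda>y. snd G (inv_into (verts (fst G)) f y))"
  have "dgraph_iso f G ?H"
    using is_graph_image(2)[OF assms f] f unfolding dgraph_iso_def by simp
  then have "is_graph (fst ?H) \<and> disomorphic G ?H"
    using is_graph_image(1)[OF assms f] unfolding disomorphic_def by auto
  then show ?thesis by blast
qed

lemma ex_nat_graph:
  assumes "is_graph (G :: 'v graph)"
  shows "\<exists>H :: nat graph. is_graph H \<and> isomorphic G H"
proof -
  have "is_graph (fst (G, \<lambda>_. ()))" using assms by simp
  from ex_nat_dgraph[OF this] obtain H :: "(nat, unit) dgraph"
    where H: "is_graph (fst H)" "disomorphic (G, \<lambda>_. ()) H" by blast
  have "H = (fst H, \<lambda>_. ())" by (simp add: prod_eq_iff fun_eq_iff)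
  with H(2) have "isomorphic G (fst H)" unfolding isomorphic_iff_unit by simp
  with H(1) show ?thesis by blast
qed


section \<open>Isoclasses\<close>

text \<open>
  Since vertex sets are finite, an isoclass is determined by its members with vertices in
  \<open>nat\<close>; \<open>graph_class G\<close> makes sense for a graph on any type of vertices.
\<close>

typedef gclass =
  "{C. \<exists>G :: nat graph. is_graph G \<and> C = {H :: nat graph. is_graph H \<and> isomorphic G H}}"
  by (rule exI[of _ "{H. is_graph H \<and> isomorphic empty_graph H}"])
     (auto simp: is_graph_def empty_graph_def)

definition graph_class :: "'v graph \<Rightarrow> gclass" where
  "graph_class G = Abs_gclass {H. is_graph H \<and> isomorphic G H}"

definition graph_rep :: "gclass \<Rightarrow> nat graph" where
  "graph_rep c = (SOME G. G \<in> Rep_gclass c)"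

typedef 'd dgclass =
  "{C. \<exists>G :: (nat, 'd) dgraph. is_graph (fst G) \<and>
         C = {H :: (nat, 'd) dgraph. is_graph (fst H) \<and> disomorphic G H}}"
  by (rule exI[of _ "{H. is_graph (fst H) \<and> disomorphic empty_dgraph H}"])
     (auto simp: is_graph_def empty_dgraph_def empty_graph_def
           intro!: exI[of _ "{}"] exI[of _ "\<lambda>_. undefined"])

definition dgraph_class :: "('v, 'd) dgraph \<Rightarrow> 'd dgclass" where
  "dgraph_class G = Abs_dgclass {H. is_graph (fst H) \<and> disomorphic G H}"

definition dgraph_rep :: "'d dgclass \<Rightarrow> (nat, 'd) dgraph" where
  "dgraph_rep c = (SOME G. G \<in> Rep_dgclass c)"

lemma Rep_dgraph_class:
  assumes "is_graph (fst (G :: ('v, 'd) dgraph))"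
  shows "Rep_dgclass (dgraph_class G) = {H. is_graph (fst H) \<and> disomorphic G H}"
proof -
  obtain H :: "(nat, 'd) dgraph" where H: "is_graph (fst H)" "disomorphic G H"
    using ex_nat_dgraph[OF assms] by blast
  have "disomorphic G K \<longleftrightarrow> disomorphic H K" for K :: "(nat, 'd) dgraph"
    by (rule disomorphic_cong[OF assms H(2)])
  then have "{K. is_graph (fst K) \<and> disomorphic G K} =
             {K :: (nat, 'd) dgraph. is_graph (fst K) \<and> disomorphic H K}" by simp
  then have "{K :: (nat, 'd) dgraph. is_graph (fst K) \<and> disomorphic G K} \<in>
      {C. \<exists>G :: (nat, 'd) dgraph. is_graph (fst G) \<and> C = {H. is_graph (fst H) \<and> disomorphic G H}}"
    by (intro CollectI exI[of _ H] conjI H(1))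
  then show ?thesis unfolding dgraph_class_def by (rule Abs_dgclass_inverse)
qed

lemma dgraph_class_eq_iff:
  assumes "is_graph (fst G)" "is_graph (fst H)"
  shows "dgraph_class G = dgraph_class H \<longleftrightarrow> disomorphic G H"
proof
  assume eq: "dgraph_class G = dgraph_class H"
  obtain K :: "(nat, 'b) dgraph" where K: "is_graph (fst K)" "disomorphic G K"
    using ex_nat_dgraph[OF assms(1)] by blast
  have "K \<in> Rep_dgclass (dgraph_class H)"
    using K Rep_dgraph_class[OF assms(1)] eq by simp
  then have "disomorphic H K" using Rep_dgraph_class[OF assms(2)] by simp
  then show "disomorphic G H"
    using disomorphic_trans[OF K(2) disomorphic_sym[OF assms(2)]] by simp
next
  assume iso: "disomorphic G H"
  have "disomorphic G K \<longleftrightarrow> disomorphic H K" for K :: "(nat, 'b) dgraph"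
    by (rule disomorphic_cong[OF assms(1) iso])
  then show "dgraph_class G = dgraph_class H" by (simp add: dgraph_class_def)
qed

lemma dgraph_rep: "is_graph (fst (dgraph_rep c))" "dgraph_class (dgraph_rep c) = c"
proof -
  obtain G :: "(nat, 'a) dgraph" where
    G: "is_graph (fst G)" "Rep_dgclass c = {H. is_graph (fst H) \<and> disomorphic G H}"
    using Rep_dgclass[of c, unfolded mem_Collect_eq] by (elim exE conjE) (rule that)
  have c: "c = dgraph_class G"
    unfolding dgraph_class_def G(2)[symmetric] by (simp only: Rep_dgclass_inverse)
  have "G \<in> Rep_dgclass c" using G disomorphic_refl[of G] by simp
  then have "dgraph_rep c \<in> Rep_dgclass c" unfolding dgraph_rep_def by (rule someI)
  then have *: "is_graph (fst (dgraph_rep c))" "disomorphic G (dgraph_rep c)" unfolding G(2) by simp_all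
  then show "is_graph (fst (dgraph_rep c))" "dgraph_class (dgraph_rep c) = c"
    using dgraph_class_eq_iff[OF G(1) *(1)] c by simp_all
qed

lemma disomorphic_dgraph_rep:
  "is_graph (fst G) \<Longrightarrow> disomorphic G (dgraph_rep (dgraph_class G))"
  using dgraph_class_eq_iff[OF _ dgraph_rep(1)] dgraph_rep(2) by metis

lemma Rep_graph_class:
  assumes "is_graph (G :: 'v graph)"
  shows "Rep_gclass (graph_class G) = {H. is_graph H \<and> isomorphic G H}"
proof -
  obtain H :: "nat graph" where H: "is_graph H" "isomorphic G H"
    using ex_nat_graph[OF assms] by blast
  have "isomorphic G K \<longleftrightarrow> isomorphic H K" for K :: "nat graph"
    by (rule isomorphic_cong[OF assms H(2)])
  then have "{K. is_graph K \<and> isomorphic G K} =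
             {K :: nat graph. is_graph K \<and> isomorphic H K}" by simp
  then have "{K :: nat graph. is_graph K \<and> isomorphic G K} \<in>
      {C. \<exists>G :: nat graph. is_graph G \<and> C = {H. is_graph H \<and> isomorphic G H}}"
    by (intro CollectI exI[of _ H] conjI H(1))
  then show ?thesis unfolding graph_class_def by (rule Abs_gclass_inverse)
qed

lemma graph_class_eq_iff:
  assumes "is_graph G" "is_graph H"
  shows "graph_class G = graph_class H \<longleftrightarrow> isomorphic G H"
proof
  assume eq: "graph_class G = graph_class H"
  obtain K :: "nat graph" where K: "is_graph K" "isomorphic G K"
    using ex_nat_graph[OF assms(1)] by blast
  have "K \<in> Rep_gclass (graph_class H)"
    using K Rep_graph_class[OF assms(1)] eq by simp
  then have "isomorphic H K" using Rep_graph_class[OF assms(2)] by simp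
  then show "isomorphic G H"
    using isomorphic_trans[OF K(2) isomorphic_sym[OF assms(2)]] by simp
next
  assume iso: "isomorphic G H"
  have "isomorphic G K \<longleftrightarrow> isomorphic H K" for K :: "nat graph"
    by (rule isomorphic_cong[OF assms(1) iso])
  then show "graph_class G = graph_class H" by (simp add: graph_class_def)
qed

lemma graph_rep: "is_graph (graph_rep c)" "graph_class (graph_rep c) = c"
proof -
  obtain G :: "nat graph" where
    G: "is_graph G" "Rep_gclass c = {H. is_graph H \<and> isomorphic G H}"
    using Rep_gclass[of c, unfolded mem_Collect_eq] by (elim exE conjE) (rule that)
  have c: "c = graph_class G"
    unfolding graph_class_def G(2)[symmetric] by (simp only: Rep_gclass_inverse)
  have "G \<in> Rep_gclass c" using G isomorphic_refl[of G] by simp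
  then have "graph_rep c \<in> Rep_gclass c" unfolding graph_rep_def by (rule someI)
  then have *: "is_graph (graph_rep c)" "isomorphic G (graph_rep c)" unfolding G(2) by simp_all
  then show "is_graph (graph_rep c)" "graph_class (graph_rep c) = c"
    using graph_class_eq_iff[OF G(1) *(1)] c by simp_all
qed

lemma isomorphic_graph_rep:
  "is_graph G \<Longrightarrow> isomorphic G (graph_rep (graph_class G))"
  using graph_class_eq_iff[OF _ graph_rep(1)] graph_rep(2) by metis


section \<open>The commutative monoid of isoclasses under disjoint union\<close>

lemma is_graph_empty: "is_graph empty_graph"
  by (simp add: is_graph_def empty_graph_def)

lemma is_graph_disjoint_union:
  assumes "is_graph G" "is_graph H"
  shows "is_graph (disjoint_union G H)"
  unfolding is_graph_def
proof (intro conjI ballI)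
  show "finite (verts (disjoint_union G H))"
    using assms by (simp add: is_graph_def disjoint_union_def)
next
  fix e assume "e \<in> edges (disjoint_union G H)"
  then consider e' where "e = Inl ` e'" "e' \<in> edges G" | e' where "e = Inr ` e'" "e' \<in> edges H"
    unfolding disjoint_union_def by auto
  then show "e \<subseteq> verts (disjoint_union G H)" "card e = 2"
    using assms unfolding is_graph_def disjoint_union_def by (cases; auto simp: card_image)+
qed

lemma graph_iso_disjoint_union:
  assumes "graph_iso f G G'" "graph_iso g H H'"
  shows "graph_iso (map_sum f g) (disjoint_union G H) (disjoint_union G' H')"
proof -
  have f: "inj_on f (verts G)" "f ` verts G = verts G'" "edges G' = (\<lambda>e. f ` e) ` edges G"
    and g: "inj_on g (verts H)" "g ` verts H = verts H'" "edges H' = (\<lambda>e. g ` e) ` edges H"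
    using assms by (simp_all add: graph_iso_def bij_betw_def)
  have "inj_on (map_sum f g) (verts G <+> verts H)"
    using f(1) g(1) by (intro inj_onI; elim PlusE; simp add: inj_on_eq_iff)
  moreover have "map_sum f g ` (verts G <+> verts H) = verts G' <+> verts H'"
    unfolding Plus_def f(2)[symmetric] g(2)[symmetric] by (simp add: image_Un image_image)
  ultimately show ?thesis
    unfolding graph_iso_def disjoint_union_def bij_betw_def f(3) g(3) fst_conv snd_conv
    by (simp add: image_Un image_image)
qed

lemma disomorphic_ddisjoint_union:
  assumes "disomorphic G G'" "disomorphic H H'"
  shows "disomorphic (ddisjoint_union G H) (ddisjoint_union G' H')"
proof -
  obtain f g where "dgraph_iso f G G'" "dgraph_iso g H H'"
    using assms unfolding disomorphic_def by auto
  then have "dgraph_iso (map_sum f g) (ddisjoint_union G H) (ddisjoint_union G' H')"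
    using graph_iso_disjoint_union[of f "fst G" "fst G'" g "fst H" "fst H'"]
    unfolding dgraph_iso_def ddisjoint_union_def
    by (auto simp: disjoint_union_def)
  then show ?thesis unfolding disomorphic_def by blast
qed

lemma graph_iso_du_comm:
  "graph_iso (case_sum Inr Inl) (disjoint_union G H) (disjoint_union H G)"
proof -
  have "inj_on (case_sum Inr Inl) (verts G <+> verts H)"
    by (intro inj_onI; elim PlusE; simp)
  moreover have "case_sum Inr Inl ` (verts G <+> verts H) = verts H <+> verts G"
    unfolding Plus_def by (simp add: image_Un image_image Un_commute)
  ultimately have "bij_betw (case_sum Inr Inl) (verts G <+> verts H) (verts H <+> verts G)"
    by (simp add: bij_betw_def)
  then show ?thesis
    unfolding graph_iso_def disjoint_union_def fst_conv snd_conv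
    by (simp add: image_Un image_image Un_commute)
qed

lemma graph_iso_du_assoc:
  "graph_iso (case_sum (case_sum Inl (Inr \<circ> Inl)) (Inr \<circ> Inr))
     (disjoint_union (disjoint_union G H) K) (disjoint_union G (disjoint_union H K))"
proof -
  let ?f = "case_sum (case_sum Inl (Inr \<circ> Inl)) (Inr \<circ> Inr)"
  have "inj_on ?f ((verts G <+> verts H) <+> verts K)"
    by (intro inj_onI; elim PlusE; simp)
  moreover have "?f ` ((verts G <+> verts H) <+> verts K) = verts G <+> (verts H <+> verts K)"
    unfolding Plus_def by (simp add: image_Un image_image Un_assoc)
  ultimately show ?thesis
    unfolding graph_iso_def disjoint_union_def bij_betw_def
    by (simp add: image_Un image_image Un_assoc)
qed

lemma graph_iso_du_empty:
  "graph_iso Inr G (disjoint_union empty_graph G)"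
  unfolding graph_iso_def disjoint_union_def empty_graph_def bij_betw_def
  by (simp add: Plus_def)

instantiation gclass :: comm_monoid_add
begin

definition "(0::gclass) = graph_class (empty_graph :: nat graph)"

definition "c + c' = graph_class (disjoint_union (graph_rep c) (graph_rep c'))"

lemma graph_class_plus:
  assumes "is_graph G" "is_graph H"
  shows "graph_class G + graph_class H = graph_class (disjoint_union G H)"
proof -
  obtain f where f: "graph_iso f G (graph_rep (graph_class G))"
    using isomorphic_graph_rep[OF assms(1)] unfolding isomorphic_def by blast
  obtain g where g: "graph_iso g H (graph_rep (graph_class H))"
    using isomorphic_graph_rep[OF assms(2)] unfolding isomorphic_def by blast
  have "isomorphic (disjoint_union G H)
          (disjoint_union (graph_rep (graph_class G)) (graph_rep (graph_class H)))"
    using graph_iso_disjoint_union[OF f g] unfolding isomorphic_def by blast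
  then show ?thesis
    unfolding plus_gclass_def using assms
    by (subst graph_class_eq_iff)
       (auto intro: isomorphic_sym is_graph_disjoint_union graph_rep(1))
qed

instance
proof
  fix a b c :: gclass
  obtain G H K :: "nat graph" where
    [simp]: "is_graph G" "is_graph H" "is_graph K"
    and [simp]: "a = graph_class G" "b = graph_class H" "c = graph_class K"
    using graph_rep by metis
  show "a + b + c = a + (b + c)"
    using graph_iso_du_assoc[of G H K]
    by (auto simp: graph_class_plus is_graph_disjoint_union graph_class_eq_iff isomorphic_def)
  show "a + b = b + a"
    using graph_iso_du_comm[of G H]
    by (auto simp: graph_class_plus is_graph_disjoint_union graph_class_eq_iff isomorphic_def)
  have "isomorphic G (disjoint_union (empty_graph :: nat graph) G)"
    using graph_iso_du_empty[of G] unfolding isomorphic_def by blast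
  then show "0 + a = a"
    by (simp add: zero_gclass_def graph_class_plus is_graph_empty graph_class_eq_iff
          is_graph_disjoint_union isomorphic_sym)
qed

end

instantiation dgclass :: (type) comm_monoid_add
begin

definition "(0::'a dgclass) = dgraph_class (empty_dgraph :: (nat, 'a) dgraph)"

definition "c + c' = dgraph_class (ddisjoint_union (dgraph_rep c) (dgraph_rep c'))"

lemma is_graph_ddisjoint_union:
  "is_graph (fst G) \<Longrightarrow> is_graph (fst H) \<Longrightarrow> is_graph (fst (ddisjoint_union G H))"
  by (simp add: ddisjoint_union_def is_graph_disjoint_union)

lemma is_graph_empty_dgraph: "is_graph (fst empty_dgraph)"
  by (simp add: empty_dgraph_def is_graph_empty)

lemma dgraph_class_plus:
  assumes "is_graph (fst G)" "is_graph (fst H)"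
  shows "dgraph_class G + dgraph_class H = dgraph_class (ddisjoint_union G H)"
proof -
  have "disomorphic (ddisjoint_union G H)
          (ddisjoint_union (dgraph_rep (dgraph_class G)) (dgraph_rep (dgraph_class H)))"
    by (intro disomorphic_ddisjoint_union disomorphic_dgraph_rep assms)
  then show ?thesis
    unfolding plus_dgclass_def using assms
    by (subst dgraph_class_eq_iff)
       (auto intro: disomorphic_sym is_graph_ddisjoint_union dgraph_rep(1))
qed

instance
proof
  fix a b c :: "'a dgclass"
  obtain G H K :: "(nat, 'a) dgraph" where
    [simp]: "is_graph (fst G)" "is_graph (fst H)" "is_graph (fst K)"
    and [simp]: "a = dgraph_class G" "b = dgraph_class H" "c = dgraph_class K"
    using dgraph_rep by metis
  have "disomorphic (ddisjoint_union (ddisjoint_union G H) K)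
                    (ddisjoint_union G (ddisjoint_union H K))"
    unfolding disomorphic_def dgraph_iso_def ddisjoint_union_def
    using graph_iso_du_assoc[of "fst G" "fst H" "fst K"]
    by (intro exI[of _ "case_sum (case_sum Inl (Inr \<circ> Inl)) (Inr \<circ> Inr)"])
       (auto split: sum.splits)
  then show "a + b + c = a + (b + c)"
    by (simp add: dgraph_class_plus is_graph_ddisjoint_union dgraph_class_eq_iff)
  have "disomorphic (ddisjoint_union G H) (ddisjoint_union H G)"
    unfolding disomorphic_def dgraph_iso_def ddisjoint_union_def
    using graph_iso_du_comm[of "fst G" "fst H"]
    by (intro exI[of _ "case_sum Inr Inl"]) (auto split: sum.splits)
  then show "a + b = b + a"
    by (simp add: dgraph_class_plus is_graph_ddisjoint_union dgraph_class_eq_iff)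
  have "disomorphic G (ddisjoint_union (empty_dgraph :: (nat, 'a) dgraph) G)"
    unfolding disomorphic_def dgraph_iso_def ddisjoint_union_def empty_dgraph_def
    using graph_iso_du_empty[of "fst G"]
    by (intro exI[of _ Inr]) auto
  then show "0 + a = a"
    by (simp add: zero_dgclass_def dgraph_class_plus is_graph_empty_dgraph dgraph_class_eq_iff
          is_graph_ddisjoint_union disomorphic_sym)
qed

end


section \<open>The bialgebras of graphs\<close>

text \<open>
  A vector space with basis \<open>'a\<close> is \<open>'a \<Rightarrow>\<^sub>0 rat\<close>, and its tensor square is the vector space
  \<open>'a \<times> 'a \<Rightarrow>\<^sub>0 rat\<close> with basis the tensors $a\otimes b$. If \<open>'a\<close> is a commutative monoid written
  additively, then \<open>'a \<Rightarrow>\<^sub>0 rat\<close> carries the product of the monoid algebra; for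
  isoclasses this is the bilinear extension of the disjoint union, with unit the empty graph.
\<close>

type_synonym H_G = "gclass \<Rightarrow>\<^sub>0 rat"
type_synonym 'd H_GD = "'d dgclass \<Rightarrow>\<^sub>0 rat"

definition pm_scale :: "rat \<Rightarrow> ('a \<Rightarrow>\<^sub>0 rat) \<Rightarrow> ('a \<Rightarrow>\<^sub>0 rat)" where
  "pm_scale q = Poly_Mapping.map ((*) q)"

definition basis :: "'a \<Rightarrow> ('a \<Rightarrow>\<^sub>0 rat)" where
  "basis a = Poly_Mapping.single a 1"

definition linear_extension ::
    "(rat \<Rightarrow> 'b \<Rightarrow> 'b::comm_monoid_add) \<Rightarrow> ('a \<Rightarrow> 'b) \<Rightarrow> ('a \<Rightarrow>\<^sub>0 rat) \<Rightarrow> 'b" where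
  "linear_extension scale f x =
     (\<Sum>a\<in>Poly_Mapping.keys x. scale (Poly_Mapping.lookup x a) (f a))"

definition graph_Delta :: "'v graph \<Rightarrow> (gclass \<times> gclass \<Rightarrow>\<^sub>0 rat)" where
  "graph_Delta G =
     (\<Sum>I\<in>Pow (verts G). basis (graph_class (induced G I), graph_class (induced G (verts G - I))))"

definition graph_delta :: "'v graph \<Rightarrow> (gclass \<times> gclass \<Rightarrow>\<^sub>0 rat)" where
  "graph_delta G =
     (\<Sum>r\<in>contractions G. basis (graph_class (contract_graph G r), graph_class (restrict_graph G r)))"

definition HG_Delta :: "H_G \<Rightarrow> (gclass \<times> gclass \<Rightarrow>\<^sub>0 rat)" where
  "HG_Delta = linear_extension pm_scale (\<lambda>c. graph_Delta (graph_rep c))"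

definition HG_delta :: "H_G \<Rightarrow> (gclass \<times> gclass \<Rightarrow>\<^sub>0 rat)" where
  "HG_delta = linear_extension pm_scale (\<lambda>c. graph_delta (graph_rep c))"

definition HG_eps :: "H_G \<Rightarrow> rat" where
  "HG_eps = linear_extension (*) (\<lambda>c. if verts (graph_rep c) = {} then 1 else 0)"

definition HG_eps' :: "H_G \<Rightarrow> rat" where
  "HG_eps' = linear_extension (*) (\<lambda>c. if edges (graph_rep c) = {} then 1 else 0)"

definition dgraph_Delta :: "('v, 'd) dgraph \<Rightarrow> ('d dgclass \<times> 'd dgclass \<Rightarrow>\<^sub>0 rat)" where
  "dgraph_Delta G =
     (\<Sum>I\<in>Pow (verts (fst G)).
        basis (dgraph_class (dinduced G I), dgraph_class (dinduced G (verts (fst G) - I))))"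

definition dgraph_delta ::
    "('v, 'd::ab_semigroup_add) dgraph \<Rightarrow> ('d dgclass \<times> 'd dgclass \<Rightarrow>\<^sub>0 rat)" where
  "dgraph_delta G =
     (\<Sum>r\<in>contractions (fst G).
        basis (dgraph_class (dcontract G r), dgraph_class (drestrict G r)))"

definition HGD_Delta :: "'d H_GD \<Rightarrow> ('d dgclass \<times> 'd dgclass \<Rightarrow>\<^sub>0 rat)" where
  "HGD_Delta = linear_extension pm_scale (\<lambda>c. dgraph_Delta (dgraph_rep c))"

definition HGD_delta :: "'d::ab_semigroup_add H_GD \<Rightarrow> ('d dgclass \<times> 'd dgclass \<Rightarrow>\<^sub>0 rat)" where
  "HGD_delta = linear_extension pm_scale (\<lambda>c. dgraph_delta (dgraph_rep c))"

definition HGD_eps :: "'d H_GD \<Rightarrow> rat" where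
  "HGD_eps = linear_extension (*) (\<lambda>c. if verts (fst (dgraph_rep c)) = {} then 1 else 0)"

definition HGD_eps' :: "'d H_GD \<Rightarrow> rat" where
  "HGD_eps' = linear_extension (*) (\<lambda>c. if edges (fst (dgraph_rep c)) = {} then 1 else 0)"

definition forget_decorations :: "'d H_GD \<Rightarrow> H_G" where
  "forget_decorations =
     linear_extension pm_scale (\<lambda>c. basis (graph_class (fst (dgraph_rep c))))"

definition P_chr :: "H_G \<Rightarrow> rat poly" where
  "P_chr = linear_extension smult (\<lambda>c. chromatic_polynomial (graph_rep c))"


section \<open>The bialgebras on \<open>\<rat>[X]\<close>\<close>

text \<open>
  The tensor square of $\mathbf{Q}[X]$ is \<open>rat poly poly\<close>, that is $\mathbf{Q}[Y][X]$, in which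
  $X^i\otimes X^j$ is $Y^jX^i$: see \<open>poly_tensor_monom\<close>. The algebra structure is the
  usual one (\<open>poly_tensor_mult\<close>).
\<close>

definition poly_tensor :: "rat poly \<Rightarrow> rat poly \<Rightarrow> rat poly poly" where
  "poly_tensor p q = map_poly (\<lambda>a. smult a q) p"

definition tensor_scale :: "rat \<Rightarrow> rat poly poly \<Rightarrow> rat poly poly" where
  "tensor_scale a = smult [:a:]"

text \<open>The algebra morphism from $\mathbf{Q}[X]$ to its tensor square sending $X$ to \<open>t\<close>.\<close>

definition poly_eval_tensor :: "rat poly poly \<Rightarrow> rat poly \<Rightarrow> rat poly poly" where
  "poly_eval_tensor t p = poly (map_poly (\<lambda>a. [:[:a:]:]) p) t"

definition poly_Delta :: "rat poly \<Rightarrow> rat poly poly" where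
  "poly_Delta = poly_eval_tensor (poly_tensor [:0, 1:] 1 + poly_tensor 1 [:0, 1:])"

definition poly_delta :: "rat poly \<Rightarrow> rat poly poly" where
  "poly_delta = poly_eval_tensor (poly_tensor [:0, 1:] [:0, 1:])"

definition poly_eps :: "rat poly \<Rightarrow> rat" where
  "poly_eps p = poly p 0"

definition poly_eps' :: "rat poly \<Rightarrow> rat" where
  "poly_eps' p = poly p 1"


section \<open>Morphisms\<close>

text \<open>\<open>tensor_square \<phi>\<close> is $\phi\otimes\phi$.\<close>

definition tensor_square ::
    "(('a \<Rightarrow>\<^sub>0 rat) \<Rightarrow> rat poly) \<Rightarrow> ('a \<times> 'a \<Rightarrow>\<^sub>0 rat) \<Rightarrow> rat poly poly" where
  "tensor_square \<phi> =
     linear_extension tensor_scale (\<lambda>(a, b). poly_tensor (\<phi> (basis a)) (\<phi> (basis b)))"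

text \<open>
  Morphisms of bialgebras from \<open>'a \<Rightarrow>\<^sub>0 rat\<close>, with coproduct \<open>coprod\<^sub>1\<close> and counit \<open>counit\<^sub>1\<close>, to
  $\mathbf{Q}[X]$, with coproduct \<open>coprod\<^sub>2\<close> and counit \<open>counit\<^sub>2\<close>. A morphism of Hopf algebras
  is a morphism of the underlying bialgebras (it then commutes with the antipodes).
\<close>

definition bialgebra_morphism ::
    "(('a::comm_monoid_add \<Rightarrow>\<^sub>0 rat) \<Rightarrow> ('a \<times> 'a \<Rightarrow>\<^sub>0 rat)) \<Rightarrow> (('a \<Rightarrow>\<^sub>0 rat) \<Rightarrow> rat) \<Rightarrow>
     (rat poly \<Rightarrow> rat poly poly) \<Rightarrow> (rat poly \<Rightarrow> rat) \<Rightarrow>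
     (('a \<Rightarrow>\<^sub>0 rat) \<Rightarrow> rat poly) \<Rightarrow> bool" where
  "bialgebra_morphism coprod\<^sub>1 counit\<^sub>1 coprod\<^sub>2 counit\<^sub>2 \<phi> \<longleftrightarrow>
     Vector_Spaces.linear pm_scale smult \<phi> \<and>
     \<phi> 1 = 1 \<and>
     (\<forall>x y. \<phi> (x * y) = \<phi> x * \<phi> y) \<and>
     (\<forall>x. tensor_square \<phi> (coprod\<^sub>1 x) = coprod\<^sub>2 (\<phi> x)) \<and>
     (\<forall>x. counit\<^sub>2 (\<phi> x) = counit\<^sub>1 x)"


section \<open>Vector spaces and tensors\<close>

lemma linear_extension_basis: "scale 1 (f a) = f a \<Longrightarrow> linear_extension scale f (basis a) = f a"
  by (simp add: linear_extension_def basis_def)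

lemma lookup_pm_scale: "Poly_Mapping.lookup (pm_scale q x) a = q * Poly_Mapping.lookup x a"
  unfolding pm_scale_def by (simp add: Poly_Mapping.map.rep_eq when_def)

lemma vector_space_pm_scale: "vector_space pm_scale"
  by unfold_locales
     (auto intro!: poly_mapping_eqI simp: lookup_pm_scale lookup_add algebra_simps)

lemma vector_space_smult: "vector_space (smult :: rat \<Rightarrow> _)"
  by unfold_locales (auto simp: smult_add_left smult_add_right)

lemma linear_linear_extension:
  assumes "vector_space scale"
  shows "Vector_Spaces.linear pm_scale scale (linear_extension scale f)"
proof -
  interpret W: vector_space scale by fact
  interpret V: vector_space pm_scale by (rule vector_space_pm_scale)
  have sup: "linear_extension scale f x = (\<Sum>a\<in>A. scale (Poly_Mapping.lookup x a) (f a))"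
    if "finite A" "Poly_Mapping.keys x \<subseteq> A" for A x
    unfolding linear_extension_def using that
    by (intro sum.mono_neutral_left) (auto simp: in_keys_iff)
  have add: "linear_extension scale f (x + y) = linear_extension scale f x + linear_extension scale f y" for x y
  proof -
    let ?A = "Poly_Mapping.keys x \<union> Poly_Mapping.keys y"
    have "Poly_Mapping.keys (x + y) \<subseteq> ?A" by (rule Poly_Mapping.keys_add)
    then show ?thesis
      by (simp add: sup[of ?A] lookup_add W.scale_left_distrib sum.distrib)
  qed
  have sc: "linear_extension scale f (pm_scale q x) = scale q (linear_extension scale f x)" for q x
  proof -
    have "Poly_Mapping.keys (pm_scale q x) \<subseteq> Poly_Mapping.keys x"
      by (auto simp: in_keys_iff lookup_pm_scale)
    then show ?thesis
      by (simp add: sup[of "Poly_Mapping.keys x"] lookup_pm_scale W.scale_sum_right)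
  qed
  show ?thesis by unfold_locales (auto simp: add sc)
qed

lemma basis_mult: "basis (a::'a::comm_monoid_add) * basis b = basis (a + b)"
  by (simp add: basis_def mult_single)

lemma basis_zero: "basis (0::'a::comm_monoid_add) = 1"
  by (simp add: basis_def)

lemma coeff_poly_tensor: "coeff (poly_tensor p q) n = smult (coeff p n) q"
  by (simp add: poly_tensor_def coeff_map_poly)

lemma poly_tensor_monom: "poly_tensor (monom a i) (monom b j) = monom (monom (a * b) j) i"
  by (rule poly_eqI) (simp add: coeff_poly_tensor smult_monom)

lemma poly_tensor_mult: "poly_tensor (p * p') (q * q') = poly_tensor p q * poly_tensor p' q'"
  by (rule poly_eqI) (simp add: coeff_poly_tensor coeff_mult smult_sum mult_ac)

lemma poly_tensor_linear:
  "poly_tensor (p + p') q = poly_tensor p q + poly_tensor p' q"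
  "poly_tensor p (q + q') = poly_tensor p q + poly_tensor p q'"
  "poly_tensor (smult a p) q = tensor_scale a (poly_tensor p q)"
  "poly_tensor p (smult a q) = tensor_scale a (poly_tensor p q)"
  by (auto intro!: poly_eqI simp: coeff_poly_tensor smult_add_left smult_add_right tensor_scale_def algebra_simps)

lemma poly_eval_tensor_pCons:
  "poly_eval_tensor t (pCons a p) = [:[:a:]:] + t * poly_eval_tensor t p"
  by (simp add: poly_eval_tensor_def map_poly_pCons)

lemma poly_eval_tensor_simps:
  "poly_eval_tensor t 0 = 0" "poly_eval_tensor t 1 = 1" "poly_eval_tensor t [:0, 1:] = t"
  by (simp_all add: poly_eval_tensor_def map_poly_pCons flip: one_pCons)

lemma poly_eval_tensor_add: "poly_eval_tensor t (p + q) = poly_eval_tensor t p + poly_eval_tensor t q"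
  by (induction p q rule: poly_induct2)
     (simp_all add: poly_eval_tensor_pCons poly_eval_tensor_simps algebra_simps)

lemma poly_eval_tensor_smult: "poly_eval_tensor t (smult a p) = tensor_scale a (poly_eval_tensor t p)"
  by (induction p)
     (simp_all add: poly_eval_tensor_pCons poly_eval_tensor_simps tensor_scale_def smult_add_right)

lemma poly_eval_tensor_mult: "poly_eval_tensor t (p * q) = poly_eval_tensor t p * poly_eval_tensor t q"
  by (induction p)
     (simp_all add: poly_eval_tensor_pCons poly_eval_tensor_simps poly_eval_tensor_add
        poly_eval_tensor_smult tensor_scale_def algebra_simps)


section \<open>Existence and uniqueness of the chromatic polynomial\<close>

lemma finite_proper_colourings: "is_graph G \<Longrightarrow> finite (proper_colourings G k)"
  unfolding proper_colourings_def is_graph_def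
  by (rule finite_subset[of _ "verts G \<rightarrow>\<^sub>E {1..k}"]) (auto intro: finite_PiE)

lemma recolour:
  assumes "is_graph G" "bij_betw u S T" "T \<subseteq> {1..k'}"
    and f: "f \<in> proper_colourings G k" "f ` verts G = S"
  shows "restrict (u \<circ> f) (verts G) \<in> {f \<in> proper_colourings G k'. f ` verts G = T}"
proof -
  let ?f = "restrict (u \<circ> f) (verts G)"
  have "?f ` verts G = u ` f ` verts G" by force
  then have im: "?f ` verts G = T" using assms(2) f(2) by (simp add: bij_betw_def)
  have "?f x \<noteq> ?f y" if xy: "{x, y} \<in> edges G" for x y
  proof -
    have V: "x \<in> verts G" "y \<in> verts G" using assms(1) xy by (auto simp: is_graph_def)
    have "f x \<noteq> f y" using f(1) xy by (simp add: proper_colourings_def)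
    moreover have "f x \<in> S" "f y \<in> S" using V f(2) by auto
    ultimately have "u (f x) \<noteq> u (f y)"
      using assms(2) unfolding bij_betw_def by (meson inj_onD)
    then show ?thesis using V by simp
  qed
  moreover have "?f \<in> verts G \<rightarrow>\<^sub>E {1..k'}"
  proof (rule PiE_I)
    fix x assume "x \<in> verts G"
    then show "?f x \<in> {1..k'}" using im assms(3) by blast
  qed simp
  ultimately show ?thesis using im by (simp add: proper_colourings_def)
qed

lemma card_proper_colourings_image:
  assumes G: "is_graph G" and S: "S \<subseteq> {1..k}"
  shows "card {f \<in> proper_colourings G k. f ` verts G = S} =
         card {f \<in> proper_colourings G (card S). f ` verts G = {1..card S}}"
proof -
  have "finite S" using S by (rule finite_subset) simp
  then have "\<exists>h. bij_betw h S {1..card S}"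
    by (intro finite_same_card_bij) auto
  then obtain h where h: "bij_betw h S {1..card S}" ..
  let ?g = "inv_into S h"
  have g: "bij_betw ?g {1..card S} S" using h by (rule bij_betw_inv_into)
  let ?V = "verts G"
  let ?A = "{f \<in> proper_colourings G k. f ` ?V = S}"
  let ?B = "{f \<in> proper_colourings G (card S). f ` ?V = {1..card S}}"
  have ext: "restrict f ?V = f" if "f \<in> proper_colourings G k'" for f k'
    using that PiE_restrict unfolding proper_colourings_def by blast
  have "bij_betw (\<lambda>f. restrict (h \<circ> f) ?V) ?A ?B"
  proof (rule bij_betw_byWitness)
    show "\<forall>f\<in>?A. restrict (?g \<circ> restrict (h \<circ> f) ?V) ?V = f"
    proof
      fix f assume f: "f \<in> ?A"
      have "restrict (?g \<circ> restrict (h \<circ> f) ?V) ?V = restrict f ?V"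
        using f bij_betw_inv_into_left[OF h] by (intro restrict_ext) auto
      with ext f show "restrict (?g \<circ> restrict (h \<circ> f) ?V) ?V = f" by auto
    qed
    show "\<forall>f\<in>?B. restrict (h \<circ> restrict (?g \<circ> f) ?V) ?V = f"
    proof
      fix f assume f: "f \<in> ?B"
      have "restrict (h \<circ> restrict (?g \<circ> f) ?V) ?V = restrict f ?V"
      proof (rule restrict_ext)
        fix x assume "x \<in> ?V"
        then have "f x \<in> {1..card S}" using f by blast
        then show "(h \<circ> restrict (?g \<circ> f) ?V) x = f x"
          using bij_betw_inv_into_right[OF h] \<open>x \<in> ?V\<close> by simp
      qed
      with ext f show "restrict (h \<circ> restrict (?g \<circ> f) ?V) ?V = f" by auto
    qed
    show "(\<lambda>f. restrict (h \<circ> f) ?V) ` ?A \<subseteq> ?B"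
      using recolour[OF G h, of "card S"] by blast
    show "(\<lambda>f. restrict (?g \<circ> f) ?V) ` ?B \<subseteq> ?A"
      using recolour[OF G g S] by blast
  qed
  then show ?thesis by (rule bij_betw_same_card)
qed

lemma card_proper_colourings:
  assumes "is_graph G"
  shows "card (proper_colourings G k) =
    (\<Sum>j\<le>card (verts G). card {f \<in> proper_colourings G j. f ` verts G = {1..j}} * (k choose j))"
proof -
  let ?s = "\<lambda>j. card {f \<in> proper_colourings G j. f ` verts G = {1..j}}"
  let ?N = "card (verts G)"
  have fin: "finite (verts G)" using assms by (simp add: is_graph_def)
  have "f ` verts G \<subseteq> {1..k}" if "f \<in> proper_colourings G k" for f
    using that by (auto simp: proper_colourings_def)
  then have un: "proper_colourings G k = (\<Union>S\<in>Pow {1..k}. {f \<in> proper_colourings G k. f ` verts G = S})"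
    by blast
  have "card (proper_colourings G k) = (\<Sum>S\<in>Pow {1..k}. card {f \<in> proper_colourings G k. f ` verts G = S})"
    by (subst un, rule card_UN_disjoint) (auto intro: finite_subset[OF _ finite_proper_colourings[OF assms]])
  also have "\<dots> = (\<Sum>S\<in>Pow {1..k}. ?s (card S))"
    by (intro sum.cong refl card_proper_colourings_image[OF assms]) auto
  also have "\<dots> = (\<Sum>j\<le>k. \<Sum>S\<in>{S \<in> Pow {1..k}. card S = j}. ?s (card S))"
  proof (rule sum.group[symmetric])
    show "card ` Pow {1..k} \<subseteq> {..k}" using card_mono[of "{1..k}"] by fastforce
  qed auto
  also have "\<dots> = (\<Sum>j\<le>k. ?s j * (k choose j))"
  proof (intro sum.cong refl)
    fix j
    have "card {S \<in> Pow {1..k}. card S = j} = k choose j"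
      using n_subsets[of "{1..k}" j] by (simp add: Pow_def)
    then show "(\<Sum>S\<in>{S \<in> Pow {1..k}. card S = j}. ?s (card S)) = ?s j * (k choose j)" by simp
  qed
  also have "\<dots> = (\<Sum>j\<le>max k ?N. ?s j * (k choose j))"
    by (rule sum.mono_neutral_left) auto
  also have "\<dots> = (\<Sum>j\<le>?N. ?s j * (k choose j))"
  proof (rule sum.mono_neutral_right)
    show "\<forall>j\<in>{..max k ?N} - {..?N}. ?s j * (k choose j) = 0"
    proof
      fix j assume "j \<in> {..max k ?N} - {..?N}"
      then have "f ` verts G \<noteq> {1..j}" for f :: "'a \<Rightarrow> nat"
        using card_image_le[OF fin, of f] by auto
      then show "?s j * (k choose j) = 0" by simp
    qed
  qed auto
  finally show ?thesis .
qed

lemma ex1_chromatic_polynomial: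
  assumes "is_graph G"
  shows "\<exists>!P :: rat poly. \<forall>k\<ge>1. poly P (of_nat k) = of_nat (card (proper_colourings G k))"
proof (rule ex_ex1I)
  define B :: "nat \<Rightarrow> rat poly" where
    "B j = smult (1 / fact j) (\<Prod>i<j. [:- of_nat i, 1:])" for j
  have B: "poly (B j) (of_nat k) = of_nat (k choose j)" for j k
    by (simp add: B_def poly_prod binomial_gbinomial gbinomial_prod_rev atLeast0LessThan)
  show "\<exists>P :: rat poly. \<forall>k\<ge>1. poly P (of_nat k) = of_nat (card (proper_colourings G k))"
    by (rule exI[of _ "\<Sum>j\<le>card (verts G).
           smult (of_nat (card {f \<in> proper_colourings G j. f ` verts G = {1..j}})) (B j)"])
       (simp add: card_proper_colourings[OF assms] poly_sum B)
next
  fix P Q :: "rat poly"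
  assume P: "\<forall>k\<ge>1. poly P (of_nat k) = of_nat (card (proper_colourings G k))"
    and Q: "\<forall>k\<ge>1. poly Q (of_nat k) = of_nat (card (proper_colourings G k))"
  have "of_nat ` {1..} \<subseteq> {x. poly (P - Q) x = 0}" using P Q by auto
  moreover have "infinite (of_nat ` {1::nat..} :: rat set)"
    by (subst finite_image_iff) (auto simp: inj_on_def infinite_Ici)
  ultimately have "infinite {x. poly (P - Q) x = 0}" using finite_subset by blast
  then have "P - Q = 0" using poly_roots_finite by blast
  then show "P = Q" by simp
qed

lemma poly_chromatic_polynomial:
  assumes "is_graph G" "k \<ge> 1"
  shows "poly (chromatic_polynomial G) (of_nat k) = of_nat (card (proper_colourings G k))"
  unfolding chromatic_polynomial_def
  using theI'[OF ex1_chromatic_polynomial[OF assms(1)]] assms(2) by blast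


section \<open>Independence of the representatives of isoclasses\<close>

lemma graph_iso_props:
  assumes "graph_iso f G H"
  shows "inj_on f (verts G)" "verts H = f ` verts G" "edges H = (\<lambda>e. f ` e) ` edges G"
  using assms by (simp_all add: graph_iso_def bij_betw_def)

lemma is_graph_induced: "is_graph G \<Longrightarrow> I \<subseteq> verts G \<Longrightarrow> is_graph (induced G I)"
  by (auto simp: is_graph_def induced_def finite_subset)

lemma is_graph_restrict: "is_graph G \<Longrightarrow> is_graph (restrict_graph G r)"
  by (auto simp: is_graph_def restrict_graph_def)

lemma is_graph_contract: "is_graph G \<Longrightarrow> is_graph (contract_graph G r)"
  by (auto simp: is_graph_def contract_graph_def quotient_def card_insert_if)

lemma graph_iso_induced:
  assumes "is_graph G" "graph_iso f G H" "I \<subseteq> verts G"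
  shows "graph_iso f (induced G I) (induced H (f ` I))"
proof -
  note f = graph_iso_props[OF assms(2)]
  have "f ` e \<subseteq> f ` I \<longleftrightarrow> e \<subseteq> I" if "e \<in> edges G" for e
  proof -
    have "e \<subseteq> verts G" using that assms(1) by (auto simp: is_graph_def)
    then show ?thesis using f(1) assms(3) unfolding inj_on_def by blast
  qed
  then have "{e \<in> edges H. e \<subseteq> f ` I} = (\<lambda>e. f ` e) ` {e \<in> edges G. e \<subseteq> I}"
    unfolding f(3) by auto
  moreover have "inj_on f I" using f(1) assms(3) by (rule inj_on_subset)
  ultimately show ?thesis by (simp add: graph_iso_def induced_def bij_betw_def)
qed

lemma connected_graph_iso:
  assumes "graph_iso f G H" "connected_graph G"
  shows "connected_graph H"
proof -
  note f = graph_iso_props[OF assms(1)]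
  have *: "(f x, f y) \<in> {(u, v). {u, v} \<in> edges H}\<^sup>*" if "(x, y) \<in> {(u, v). {u, v} \<in> edges G}\<^sup>*" for x y
    using that
  proof induction
    case (step y z)
    then have "f ` {y, z} \<in> edges H" unfolding f(3) by blast
    then have "(f y, f z) \<in> {(u, v). {u, v} \<in> edges H}" by simp
    with step.IH show ?case by (rule rtrancl_into_rtrancl)
  qed simp
  show ?thesis
    unfolding connected_graph_def f(2)
  proof (intro conjI ballI)
    show "f ` verts G \<noteq> {}" using assms(2) by (simp add: connected_graph_def)
    fix x y assume "x \<in> f ` verts G" "y \<in> f ` verts G"
    then obtain a b where "x = f a" "y = f b" "a \<in> verts G" "b \<in> verts G" by blast
    with * assms(2) show "(x, y) \<in> {(u, v). {u, v} \<in> edges H}\<^sup>*"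
      unfolding connected_graph_def by blast
  qed
qed

lemma quotient_map_prod:
  assumes "inj_on f A" "r \<subseteq> A \<times> A"
  shows "(f ` A) // (map_prod f f ` r) = (\<lambda>c. f ` c) ` (A // r)"
proof -
  have "(map_prod f f ` r) `` {f x} = f ` (r `` {x})" if "x \<in> A" for x
  proof
    show "f ` (r `` {x}) \<subseteq> (map_prod f f ` r) `` {f x}" by force
    show "(map_prod f f ` r) `` {f x} \<subseteq> f ` (r `` {x})"
    proof
      fix y assume "y \<in> (map_prod f f ` r) `` {f x}"
      then obtain a b where ab: "(a, b) \<in> r" "f a = f x" "y = f b" by auto
      then have "a \<in> A" using assms(2) by blast
      then have "a = x" using ab(2) that assms(1) by (simp add: inj_on_eq_iff)
      with ab show "y \<in> f ` (r `` {x})" by blast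
    qed
  qed
  then show ?thesis unfolding quotient_def by (simp add: image_UN)
qed

lemma equiv_map_prod:
  assumes "inj_on f A" "equiv A r"
  shows "equiv (f ` A) (map_prod f f ` r)"
proof (rule equivI)
  have r: "r \<subseteq> A \<times> A" "refl_on A r" "sym r" "trans r" using assms(2) by (auto simp: equiv_def)
  show "map_prod f f ` r \<subseteq> f ` A \<times> f ` A" using r(1) by auto
  show "refl_on (f ` A) (map_prod f f ` r)" using r(2) by (force simp: refl_on_def)
  show "sym (map_prod f f ` r)" using r(3) by (force simp: sym_def)
  show "trans (map_prod f f ` r)"
  proof (rule transI)
    fix x y z assume "(x, y) \<in> map_prod f f ` r" "(y, z) \<in> map_prod f f ` r"
    then obtain a b b' c where *: "(a, b) \<in> r" "(b', c) \<in> r" "x = f a" "y = f b" "y = f b'" "z = f c"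
      by auto
    then have "b \<in> A" "b' \<in> A" using r(1) by auto
    then have "b = b'" using * assms(1) by (simp add: inj_on_eq_iff)
    then have "(a, c) \<in> r" using * r(4) by (meson transD)
    then show "(x, z) \<in> map_prod f f ` r" using * by force
  qed
qed

lemma graph_iso_restrict:
  assumes "is_graph G" "graph_iso f G H" "r \<subseteq> verts G \<times> verts G"
  shows "graph_iso f (restrict_graph G r) (restrict_graph H (map_prod f f ` r))"
proof -
  note f = graph_iso_props[OF assms(2)]
  have "edges (restrict_graph H (map_prod f f ` r)) = (\<lambda>e. f ` e) ` edges (restrict_graph G r)"
  proof (intro equalityI subsetI)
    fix e assume "e \<in> edges (restrict_graph H (map_prod f f ` r))"
    then obtain x y where e: "e = {x, y}" "{x, y} \<in> edges H" "(x, y) \<in> map_prod f f ` r"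
      by (auto simp: restrict_graph_def)
    then obtain a b where ab: "(a, b) \<in> r" "x = f a" "y = f b" by auto
    then have "a \<in> verts G" "b \<in> verts G" using assms(3) by auto
    then have "{a, b} \<in> edges G"
      using graph_iso_edge_iff[OF assms(1,2)] e(2) ab by blast
    then have "{a, b} \<in> edges (restrict_graph G r)" using ab(1) by (auto simp: restrict_graph_def)
    moreover have "e = f ` {a, b}" using e ab by simp
    ultimately show "e \<in> (\<lambda>e. f ` e) ` edges (restrict_graph G r)" by blast
  next
    fix e assume "e \<in> (\<lambda>e. f ` e) ` edges (restrict_graph G r)"
    then obtain a b where ab: "e = f ` {a, b}" "{a, b} \<in> edges G" "(a, b) \<in> r"
      by (auto simp: restrict_graph_def)
    have "f ` {a, b} \<in> edges H" unfolding f(3) using ab(2) by blast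
    moreover have "(f a, f b) \<in> map_prod f f ` r" using ab(3) by force
    ultimately have "{f a, f b} \<in> edges H" "(f a, f b) \<in> map_prod f f ` r" by simp_all
    moreover have "e = {f a, f b}" using ab(1) by simp
    ultimately show "e \<in> edges (restrict_graph H (map_prod f f ` r))" 
      unfolding restrict_graph_def snd_conv
      by (intro CollectI exI[of _ "f a"] exI[of _ "f b"] conjI)
  qed
  then show ?thesis using assms(2) by (simp add: graph_iso_def restrict_graph_def)
qed

lemma graph_iso_contract:
  assumes "is_graph G" "graph_iso f G H" "equiv (verts G) r"
  shows "graph_iso (\<lambda>c. f ` c) (contract_graph G r) (contract_graph H (map_prod f f ` r))"
proof -
  note f = graph_iso_props[OF assms(2)]
  have r: "r \<subseteq> verts G \<times> verts G" using assms(3) by (simp add: equiv_def)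
  have Q: "verts H // (map_prod f f ` r) = (\<lambda>c. f ` c) ` (verts G // r)"
    unfolding f(2) by (rule quotient_map_prod[OF f(1) r])
  have sub: "c \<subseteq> verts G" if "c \<in> verts G // r" for c
    using that r by (auto simp: quotient_def)
  have inj: "inj_on (\<lambda>c. f ` c) (verts G // r)"
    using sub f(1) by (intro inj_onI) (simp add: inj_on_image_eq_iff)
  have adj: "(\<exists>x\<in>f ` c. \<exists>y\<in>f ` c'. {x, y} \<in> edges H) \<longleftrightarrow> (\<exists>x\<in>c. \<exists>y\<in>c'. {x, y} \<in> edges G)"
    if "c \<in> verts G // r" "c' \<in> verts G // r" for c c'
  proof -
    have "{f x, f y} \<in> edges H \<longleftrightarrow> {x, y} \<in> edges G" if "x \<in> c" "y \<in> c'" for x y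
      using graph_iso_edge_iff[OF assms(1,2)] sub \<open>c \<in> _\<close> \<open>c' \<in> _\<close> that by blast
    then show ?thesis by blast
  qed
  have ne: "f ` c \<noteq> f ` c' \<longleftrightarrow> c \<noteq> c'" if "c \<in> verts G // r" "c' \<in> verts G // r" for c c'
    using inj that by (simp add: inj_on_eq_iff)
  have "edges (contract_graph H (map_prod f f ` r)) = (\<lambda>e. (\<lambda>c. f ` c) ` e) ` edges (contract_graph G r)"
  proof (intro equalityI subsetI)
    fix e assume "e \<in> edges (contract_graph H (map_prod f f ` r))"
    then obtain d d' where d: "e = {d, d'}" "d \<in> verts H // (map_prod f f ` r)"
        "d' \<in> verts H // (map_prod f f ` r)" "d \<noteq> d'" "\<exists>x\<in>d. \<exists>y\<in>d'. {x, y} \<in> edges H"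
      by (auto simp: contract_graph_def)
    then obtain c c' where c: "c \<in> verts G // r" "c' \<in> verts G // r" "d = f ` c" "d' = f ` c'"
      unfolding Q by blast
    then have "{c, c'} \<in> edges (contract_graph G r)"
      using d adj[OF c(1,2)] ne[OF c(1,2)] unfolding contract_graph_def snd_conv by blast
    moreover have "e = (\<lambda>c. f ` c) ` {c, c'}" using d c by simp
    ultimately show "e \<in> (\<lambda>e. (\<lambda>c. f ` c) ` e) ` edges (contract_graph G r)" by blast
  next
    fix e assume "e \<in> (\<lambda>e. (\<lambda>c. f ` c) ` e) ` edges (contract_graph G r)"
    then obtain c c' where c: "e = {f ` c, f ` c'}" "c \<in> verts G // r" "c' \<in> verts G // r" "c \<noteq> c'"
        "\<exists>x\<in>c. \<exists>y\<in>c'. {x, y} \<in> edges G"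
      by (auto simp: contract_graph_def)
    then have "f ` c \<in> verts H // (map_prod f f ` r)" "f ` c' \<in> verts H // (map_prod f f ` r)"
      "f ` c \<noteq> f ` c'" "\<exists>x\<in>f ` c. \<exists>y\<in>f ` c'. {x, y} \<in> edges H"
      using adj[OF c(2,3)] ne[OF c(2,3)] unfolding Q by blast+
    then show "e \<in> edges (contract_graph H (map_prod f f ` r))"
      unfolding contract_graph_def snd_conv c(1) by blast
  qed
  then show ?thesis using inj by (simp add: graph_iso_def contract_graph_def bij_betw_def Q)
qed

lemma contractions_map_prod:
  assumes "is_graph G" "graph_iso f G H" "r \<in> contractions G"
  shows "map_prod f f ` r \<in> contractions H"
proof -
  note f = graph_iso_props[OF assms(2)]
  have eq: "equiv (verts G) r" and con: "\<And>c. c \<in> verts G // r \<Longrightarrow> connected_graph (induced G c)"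
    using assms(3) by (auto simp: contractions_def)
  have r: "r \<subseteq> verts G \<times> verts G" using eq by (simp add: equiv_def)
  have "connected_graph (induced H d)" if "d \<in> verts H // (map_prod f f ` r)" for d
  proof -
    from that obtain c where c: "c \<in> verts G // r" "d = f ` c"
      unfolding f(2) quotient_map_prod[OF f(1) r] by blast
    have "c \<subseteq> verts G" using c(1) r by (auto simp: quotient_def)
    then show ?thesis
      using connected_graph_iso[OF graph_iso_induced[OF assms(1,2)] con[OF c(1)]] c(2) by simp
  qed
  moreover have "equiv (verts H) (map_prod f f ` r)"
    unfolding f(2) by (rule equiv_map_prod[OF f(1) eq])
  ultimately show ?thesis by (simp add: contractions_def)
qed

lemma graph_iso_inv:
  assumes "is_graph G" "graph_iso f G H"
  shows "graph_iso (inv_into (verts G) f) H G"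
  using dgraph_iso_inv[of "(G, \<lambda>_. ())" f "(H, \<lambda>_. ())"] assms by (simp add: dgraph_iso_def)

lemma is_graph_iso:
  assumes "is_graph G" "graph_iso f G H"
  shows "is_graph H"
  using is_graph_image(1)[OF assms(1) graph_iso_props(1)[OF assms(2)]] graph_iso_props(2,3)[OF assms(2)]
  by (metis prod.collapse)

lemma bij_betw_contractions:
  assumes "is_graph G" "graph_iso f G H"
  shows "bij_betw (\<lambda>r. map_prod f f ` r) (contractions G) (contractions H)"
proof (rule bij_betw_byWitness)
  let ?g = "inv_into (verts G) f"
  note f = graph_iso_props[OF assms(2)]
  have H: "is_graph H" and g: "graph_iso ?g H G"
    using is_graph_iso[OF assms] graph_iso_inv[OF assms] by auto
  show "\<forall>r\<in>contractions G. map_prod ?g ?g ` map_prod f f ` r = r"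
  proof
    fix r assume "r \<in> contractions G"
    then have "r \<subseteq> verts G \<times> verts G" by (auto simp: contractions_def equiv_def)
    then have "\<And>p. p \<in> r \<Longrightarrow> map_prod ?g ?g (map_prod f f p) = p" using f(1) by auto
    then show "map_prod ?g ?g ` map_prod f f ` r = r" by (simp add: image_image)
  qed
  show "\<forall>r\<in>contractions H. map_prod f f ` map_prod ?g ?g ` r = r"
  proof
    fix r assume "r \<in> contractions H"
    then have "r \<subseteq> verts H \<times> verts H" by (auto simp: contractions_def equiv_def)
    then have "\<And>p. p \<in> r \<Longrightarrow> map_prod f f (map_prod ?g ?g p) = p"
      unfolding f(2) by (auto simp: f_inv_into_f)
    then show "map_prod f f ` map_prod ?g ?g ` r = r" by (simp add: image_image)
  qed
  show "(\<lambda>r. map_prod f f ` r) ` contractions G \<subseteq> contractions H"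
    using contractions_map_prod[OF assms] by blast
  show "(\<lambda>r. map_prod ?g ?g ` r) ` contractions H \<subseteq> contractions G"
    using contractions_map_prod[OF H g] by blast
qed

lemma bij_betw_Pow_image:
  assumes "inj_on f A"
  shows "bij_betw (\<lambda>I. f ` I) (Pow A) (Pow (f ` A))"
  using assms by (simp add: bij_betw_def inj_on_image_Pow image_Pow_surj)

lemma graph_Delta_iso:
  assumes "is_graph G" "isomorphic G H"
  shows "graph_Delta G = graph_Delta H"
proof -
  obtain f where iso: "graph_iso f G H" using assms(2) by (auto simp: isomorphic_def)
  note f = graph_iso_props[OF iso]
  have *: "graph_class (induced G I) = graph_class (induced H (f ` I))" if "I \<subseteq> verts G" for I
  proof -
    note i = graph_iso_induced[OF assms(1) iso that] and g = is_graph_induced[OF assms(1) that]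
    show ?thesis using i unfolding graph_class_eq_iff[OF g is_graph_iso[OF g i]] isomorphic_def by blast
  qed
  have "graph_Delta H = (\<Sum>I\<in>Pow (verts G).
      basis (graph_class (induced H (f ` I)), graph_class (induced H (verts H - f ` I))))"
    unfolding graph_Delta_def f(2)
    by (rule sum.reindex_bij_betw[OF bij_betw_Pow_image[OF f(1)], symmetric])
  also have "\<dots> = graph_Delta G"
    unfolding graph_Delta_def
  proof (intro sum.cong refl)
    fix I assume I: "I \<in> Pow (verts G)"
    then have "verts H - f ` I = f ` (verts G - I)"
      unfolding f(2) using inj_on_image_set_diff[OF f(1), of "verts G" I] by simp
    with I * show "basis (graph_class (induced H (f ` I)), graph_class (induced H (verts H - f ` I))) =
       basis (graph_class (induced G I), graph_class (induced G (verts G - I)))" by simp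
  qed
  finally show ?thesis ..
qed

lemma graph_delta_iso:
  assumes "is_graph G" "isomorphic G H"
  shows "graph_delta G = graph_delta H"
proof -
  obtain f where iso: "graph_iso f G H" using assms(2) by (auto simp: isomorphic_def)
  have "graph_delta H = (\<Sum>r\<in>contractions G.
      basis (graph_class (contract_graph H (map_prod f f ` r)), graph_class (restrict_graph H (map_prod f f ` r))))"
    unfolding graph_delta_def
    by (rule sum.reindex_bij_betw[OF bij_betw_contractions[OF assms(1) iso], symmetric])
  also have "\<dots> = graph_delta G"
    unfolding graph_delta_def
  proof (intro sum.cong refl)
    fix r assume r: "r \<in> contractions G"
    then have eq: "equiv (verts G) r" by (simp add: contractions_def)
    then have sub: "r \<subseteq> verts G \<times> verts G" by (simp add: equiv_def)
    note c = graph_iso_contract[OF assms(1) iso eq] and s = graph_iso_restrict[OF assms(1) iso sub]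
    have "graph_class (contract_graph G r) = graph_class (contract_graph H (map_prod f f ` r))"
      using c is_graph_iso[OF is_graph_contract[OF assms(1)] c] is_graph_contract[OF assms(1)]
        graph_class_eq_iff unfolding isomorphic_def by blast
    moreover have "graph_class (restrict_graph G r) = graph_class (restrict_graph H (map_prod f f ` r))"
      using s is_graph_iso[OF is_graph_restrict[OF assms(1)] s] is_graph_restrict[OF assms(1)]
        graph_class_eq_iff unfolding isomorphic_def by blast
    ultimately show "basis (graph_class (contract_graph H (map_prod f f ` r)), graph_class (restrict_graph H (map_prod f f ` r))) =
       basis (graph_class (contract_graph G r), graph_class (restrict_graph G r))" by simp
  qed
  finally show ?thesis ..
qed

lemma dgraph_Delta_iso:
  assumes "is_graph (fst G)" "disomorphic G H"
  shows "dgraph_Delta G = dgraph_Delta H"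
proof -
  obtain f where diso: "dgraph_iso f G H" using assms(2) by (auto simp: disomorphic_def)
  then have iso: "graph_iso f (fst G) (fst H)" by (rule dgraph_iso_imp_graph_iso)
  note f = graph_iso_props[OF iso]
  have *: "dgraph_class (dinduced G I) = dgraph_class (dinduced H (f ` I))" if "I \<subseteq> verts (fst G)" for I
  proof -
    note i = graph_iso_induced[OF assms(1) iso that] and g = is_graph_induced[OF assms(1) that]
    have "dgraph_iso f (dinduced G I) (dinduced H (f ` I))"
      using i diso that by (simp add: dgraph_iso_def dinduced_def induced_def subset_iff)
    then have "disomorphic (dinduced G I) (dinduced H (f ` I))"
      unfolding disomorphic_def by blast
    moreover have "is_graph (fst (dinduced G I))" "is_graph (fst (dinduced H (f ` I)))"
      using g is_graph_iso[OF g i] by (simp_all add: dinduced_def)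
    ultimately show ?thesis by (simp add: dgraph_class_eq_iff)
  qed
  have "dgraph_Delta H = (\<Sum>I\<in>Pow (verts (fst G)).
      basis (dgraph_class (dinduced H (f ` I)), dgraph_class (dinduced H (verts (fst H) - f ` I))))"
    unfolding dgraph_Delta_def f(2)
    by (rule sum.reindex_bij_betw[OF bij_betw_Pow_image[OF f(1)], symmetric])
  also have "\<dots> = dgraph_Delta G"
    unfolding dgraph_Delta_def
  proof (intro sum.cong refl)
    fix I assume I: "I \<in> Pow (verts (fst G))"
    then have "verts (fst H) - f ` I = f ` (verts (fst G) - I)"
      unfolding f(2) using inj_on_image_set_diff[OF f(1), of "verts (fst G)" I] by simp
    with I * show "basis (dgraph_class (dinduced H (f ` I)), dgraph_class (dinduced H (verts (fst H) - f ` I))) =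
       basis (dgraph_class (dinduced G I), dgraph_class (dinduced G (verts (fst G) - I)))" by simp
  qed
  finally show ?thesis ..
qed

lemma dgraph_delta_iso:
  assumes "is_graph (fst G)" "disomorphic G H"
  shows "dgraph_delta G = dgraph_delta H"
proof -
  obtain f where diso: "dgraph_iso f G H" using assms(2) by (auto simp: disomorphic_def)
  then have iso: "graph_iso f (fst G) (fst H)" by (rule dgraph_iso_imp_graph_iso)
  note f = graph_iso_props[OF iso]
  have d: "snd H (f x) = snd G x" if "x \<in> verts (fst G)" for x
    using diso that by (simp add: dgraph_iso_def)
  have "dgraph_delta H = (\<Sum>r\<in>contractions (fst G).
      basis (dgraph_class (dcontract H (map_prod f f ` r)), dgraph_class (drestrict H (map_prod f f ` r))))"
    unfolding dgraph_delta_def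
    by (rule sum.reindex_bij_betw[OF bij_betw_contractions[OF assms(1) iso], symmetric])
  also have "\<dots> = dgraph_delta G"
    unfolding dgraph_delta_def
  proof (intro sum.cong refl)
    fix r assume r: "r \<in> contractions (fst G)"
    then have eq: "equiv (verts (fst G)) r" by (simp add: contractions_def)
    then have sub: "r \<subseteq> verts (fst G) \<times> verts (fst G)" by (simp add: equiv_def)
    note c = graph_iso_contract[OF assms(1) iso eq] and s = graph_iso_restrict[OF assms(1) iso sub]
    have "semigroup_sum (snd H) (f ` x) = semigroup_sum (snd G) x" if "x \<in> verts (fst G) // r" for x
    proof (rule semigroup_sum_image)
      have x: "x \<subseteq> verts (fst G)" using that sub by (auto simp: quotient_def)
      then show "finite x" "inj_on f x" using assms(1) f(1)
        by (auto simp: is_graph_def intro: finite_subset inj_on_subset)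
      show "x \<noteq> {}" using in_quotient_imp_non_empty[OF eq that] .
      show "snd H (f y) = snd G y" if "y \<in> x" for y using d x that by blast
    qed
    then have "dgraph_iso (\<lambda>c. f ` c) (dcontract G r) (dcontract H (map_prod f f ` r))"
      using c by (simp add: dgraph_iso_def dcontract_def contract_graph_def)
    then have "disomorphic (dcontract G r) (dcontract H (map_prod f f ` r))"
      unfolding disomorphic_def by blast
    moreover have "is_graph (fst (dcontract G r))" "is_graph (fst (dcontract H (map_prod f f ` r)))"
      using is_graph_contract[OF assms(1)] is_graph_iso[OF is_graph_contract[OF assms(1)] c]
      by (simp_all add: dcontract_def)
    ultimately have cc: "dgraph_class (dcontract G r) = dgraph_class (dcontract H (map_prod f f ` r))"
      by (simp add: dgraph_class_eq_iff)
    have "dgraph_iso f (drestrict G r) (drestrict H (map_prod f f ` r))"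
      using s d by (simp add: dgraph_iso_def drestrict_def restrict_graph_def)
    then have "disomorphic (drestrict G r) (drestrict H (map_prod f f ` r))"
      unfolding disomorphic_def by blast
    moreover have "is_graph (fst (drestrict G r))" "is_graph (fst (drestrict H (map_prod f f ` r)))"
      using is_graph_restrict[OF assms(1)] is_graph_iso[OF is_graph_restrict[OF assms(1)] s]
      by (simp_all add: drestrict_def)
    ultimately have "dgraph_class (drestrict G r) = dgraph_class (drestrict H (map_prod f f ` r))"
      by (simp add: dgraph_class_eq_iff)
    with cc show "basis (dgraph_class (dcontract H (map_prod f f ` r)), dgraph_class (drestrict H (map_prod f f ` r))) =
       basis (dgraph_class (dcontract G r), dgraph_class (drestrict G r))" by simp
  qed
  finally show ?thesis ..
qed

lemma proper_colourings_comp: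
  assumes "is_graph G" "graph_iso f G H" "c \<in> proper_colourings H k"
  shows "restrict (c \<circ> f) (verts G) \<in> proper_colourings G k"
proof -
  note f = graph_iso_props[OF assms(2)]
  have c: "c \<in> f ` verts G \<rightarrow>\<^sub>E {1..k}" "\<And>x y. {x, y} \<in> edges H \<Longrightarrow> c x \<noteq> c y"
    using assms(3) unfolding proper_colourings_def f(2) by blast+
  have "restrict (c \<circ> f) (verts G) x \<noteq> restrict (c \<circ> f) (verts G) y" if xy: "{x, y} \<in> edges G" for x y
  proof -
    have V: "x \<in> verts G" "y \<in> verts G" using assms(1) xy by (auto simp: is_graph_def)
    then have "{f x, f y} \<in> edges H" using graph_iso_edge_iff[OF assms(1,2)] xy by blast
    then show ?thesis using c(2) V by simp
  qed
  moreover have "restrict (c \<circ> f) (verts G) \<in> verts G \<rightarrow>\<^sub>E {1..k}"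
    using c(1) by (intro PiE_I) auto
  ultimately show ?thesis unfolding proper_colourings_def by blast
qed

lemma card_proper_colourings_le:
  assumes "is_graph G" "graph_iso f G H"
  shows "card (proper_colourings H k) \<le> card (proper_colourings G k)"
proof (rule card_inj_on_le)
  note f = graph_iso_props[OF assms(2)]
  show "inj_on (\<lambda>c. restrict (c \<circ> f) (verts G)) (proper_colourings H k)"
  proof (rule inj_onI)
    fix c c' assume c: "c \<in> proper_colourings H k" "c' \<in> proper_colourings H k"
      and eq: "restrict (c \<circ> f) (verts G) = restrict (c' \<circ> f) (verts G)"
    have m: "c \<in> verts H \<rightarrow>\<^sub>E {1..k}" "c' \<in> verts H \<rightarrow>\<^sub>E {1..k}"
      using c by (simp_all add: proper_colourings_def)
    show "c = c'"
    proof (rule PiE_ext[OF m])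
      fix y assume "y \<in> verts H"
      then obtain x where "x \<in> verts G" "y = f x" unfolding f(2) by (rule imageE)
      then show "c y = c' y" using fun_cong[OF eq, of x] by simp
    qed
  qed
  show "(\<lambda>c. restrict (c \<circ> f) (verts G)) ` proper_colourings H k \<subseteq> proper_colourings G k"
    using proper_colourings_comp[OF assms] by blast
qed (rule finite_proper_colourings[OF assms(1)])

lemma chromatic_polynomial_iso:
  assumes "is_graph G" "isomorphic G H"
  shows "chromatic_polynomial G = chromatic_polynomial H"
proof -
  obtain f where f: "graph_iso f G H" using assms(2) unfolding isomorphic_def by blast
  have "card (proper_colourings G k) = card (proper_colourings H k)" for k
    using card_proper_colourings_le[OF assms(1) f]
      card_proper_colourings_le[OF is_graph_iso[OF assms(1) f] graph_iso_inv[OF assms(1) f]]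
    by (rule order_antisym[rotated])
  then show ?thesis unfolding chromatic_polynomial_def by simp
qed

lemma isomorphic_empty_iff:
  assumes "isomorphic G H"
  shows "verts H = {} \<longleftrightarrow> verts G = {}" "edges H = {} \<longleftrightarrow> edges G = {}"
proof -
  obtain f where "graph_iso f G H" using assms unfolding isomorphic_def by blast
  note f = graph_iso_props[OF this]
  show "verts H = {} \<longleftrightarrow> verts G = {}" "edges H = {} \<longleftrightarrow> edges G = {}"
    by (simp_all add: f(2,3))
qed

lemma disomorphic_imp_isomorphic: "disomorphic G H \<Longrightarrow> isomorphic (fst G) (fst H)"
  unfolding disomorphic_def isomorphic_def using dgraph_iso_imp_graph_iso by metis

lemma pm_scale_one: "pm_scale 1 x = x"
  by (rule poly_mapping_eqI) (simp add: lookup_pm_scale)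

lemma H_G_basis:
  assumes "is_graph G"
  shows "HG_Delta (basis (graph_class G)) = graph_Delta G"
    and "HG_delta (basis (graph_class G)) = graph_delta G"
    and "HG_eps (basis (graph_class G)) = (if verts G = {} then 1 else 0)"
    and "HG_eps' (basis (graph_class G)) = (if edges G = {} then 1 else 0)"
    and "P_chr (basis (graph_class G)) = chromatic_polynomial G"
proof -
  note iso = isomorphic_graph_rep[OF assms]
  show "HG_Delta (basis (graph_class G)) = graph_Delta G"
    using graph_Delta_iso[OF assms iso]
    by (simp add: HG_Delta_def linear_extension_basis pm_scale_one)
  show "HG_delta (basis (graph_class G)) = graph_delta G"
    using graph_delta_iso[OF assms iso]
    by (simp add: HG_delta_def linear_extension_basis pm_scale_one)
  show "P_chr (basis (graph_class G)) = chromatic_polynomial G"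
    using chromatic_polynomial_iso[OF assms iso]
    by (simp add: P_chr_def linear_extension_basis)
  show "HG_eps (basis (graph_class G)) = (if verts G = {} then 1 else 0)"
    "HG_eps' (basis (graph_class G)) = (if edges G = {} then 1 else 0)"
    using isomorphic_empty_iff[OF iso]
    by (simp_all add: HG_eps_def HG_eps'_def linear_extension_basis)
qed

lemma H_GD_basis:
  assumes "is_graph (fst G)"
  shows "HGD_Delta (basis (dgraph_class G)) = dgraph_Delta G"
    and "HGD_eps (basis (dgraph_class G)) = (if verts (fst G) = {} then 1 else 0)"
    and "HGD_eps' (basis (dgraph_class G)) = (if edges (fst G) = {} then 1 else 0)"
    and "forget_decorations (basis (dgraph_class G)) = basis (graph_class (fst G))"
proof -
  note iso = disomorphic_dgraph_rep[OF assms]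
  note iso' = disomorphic_imp_isomorphic[OF iso]
  have "graph_class (fst (dgraph_rep (dgraph_class G))) = graph_class (fst G)"
    using iffD2[OF graph_class_eq_iff[OF assms dgraph_rep(1)] iso'] by (rule sym)
  then show "forget_decorations (basis (dgraph_class G)) = basis (graph_class (fst G))"
    by (simp add: forget_decorations_def linear_extension_basis pm_scale_one)
  show "HGD_Delta (basis (dgraph_class G)) = dgraph_Delta G"
    using dgraph_Delta_iso[OF assms iso]
    by (simp add: HGD_Delta_def linear_extension_basis pm_scale_one)
  show "HGD_eps (basis (dgraph_class G)) = (if verts (fst G) = {} then 1 else 0)"
    "HGD_eps' (basis (dgraph_class G)) = (if edges (fst G) = {} then 1 else 0)"
    using isomorphic_empty_iff[OF iso']
    by (simp_all add: HGD_eps_def HGD_eps'_def linear_extension_basis)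
qed

lemma HGD_delta_basis:
  assumes "is_graph (fst G)"
  shows "HGD_delta (basis (dgraph_class G)) = dgraph_delta G"
  using dgraph_delta_iso[OF assms disomorphic_dgraph_rep[OF assms]]
  by (simp add: HGD_delta_def linear_extension_basis pm_scale_one)

end

theory Submission
  imports Defs
begin

text \<open>
  A polynomial in one or two variables is determined by its values at positive integers. The value of
  $P\otimes Q$ at $(k, l)$ is $P(k) Q(l)$, while $\Delta(P)$ and $\delta(P)$ take there the values
  $P(k + l)$ and $P(k l)$. Hence \<open>P_chr\<close> is compatible with the coproducts if and only if the numbers of
  proper colourings satisfy, for $k, l\geq 1$,
  \[ P_G(k + l) = \sum_{I\subseteq V(G)} P_{G_{|I}}(k) P_{G_{|V(G) - I}}(l), \qquad
     P_G(k l) = \sum_{\sim\triangleleft G} P_{G/\sim}(k) P_{G|\sim}(l). \]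
  Both come from bijections. For the first (\<open>card_colourings_Plus\<close>), use a disjoint sum of two sets of
  colours and let $I$ be the set of vertices with a colour in the first one. For the second
  (\<open>card_colourings_Times\<close>), use pairs as colours and let the classes of $\sim$ be the connected
  components of the graph formed by the edges whose ends agree in the first component. Multiplicativity
  is the independence of the colourings of the two parts of a disjoint union, and the counits
  are the values of the chromatic polynomial at $0$ and $1$.

  For uniqueness (\<open>bialgebra_morphism_unique\<close>), let $\phi$ be a morphism for both structures. Evaluating
  compatibility with $\Delta$ at $(k, 1)$ gives
  \[ \phi(G)(k + 1) = \sum_{I\subseteq V(G)} \phi(G_{|I})(k)\, \varepsilon'(G_{|V(G) - I}), \]
  and $\phi(G)(0) = \varepsilon(G)$. So all values of $\phi(G)$ at natural numbers are prescribed.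

  Finally, forgetting decorations is a surjective map compatible with both structures. Composition with
  it carries existence from graphs to decorated graphs, and uniqueness in the opposite direction.
\<close>


section \<open>Polynomials in two variables and their values at natural numbers\<close>

lemma poly_eqI_of_nat:
  fixes p q :: "'a::{idom,ring_char_0} poly"
  assumes "\<And>k. k \<ge> 1 \<Longrightarrow> poly p (of_nat k) = poly q (of_nat k)"
  shows "p = q"
proof -
  have "of_nat ` {1..} \<subseteq> {x. poly (p - q) x = 0}" using assms by auto
  moreover have "infinite (of_nat ` {1::nat..} :: 'a set)"
    by (subst finite_image_iff) (auto simp: inj_on_def infinite_Ici)
  ultimately have "infinite {x. poly (p - q) x = 0}" using finite_subset by blast
  then show ?thesis using poly_roots_finite[of "p - q"] by auto
qed

text \<open>
  The value at $(x, y)$ of a polynomial in two variables, with \<open>X\<close>, the outer variable, carrying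
  the left tensor factor and \<open>Y\<close>, the inner one, the right factor.
\<close>

definition eval2 :: "rat poly poly \<Rightarrow> rat \<Rightarrow> rat \<Rightarrow> rat" where
  "eval2 T x y = poly (poly T [:x:]) y"

lemma eval2_add: "eval2 (S + T) x y = eval2 S x y + eval2 T x y"
  by (simp add: eval2_def)

lemma eval2_sum: "eval2 (\<Sum>i\<in>A. T i) x y = (\<Sum>i\<in>A. eval2 (T i) x y)"
  by (simp add: eval2_def poly_sum)

lemma eval2_poly_tensor: "eval2 (poly_tensor p q) x y = poly p x * poly q y"
proof (induction p)
  case 0
  show ?case by (simp add: poly_tensor_def eval2_def)
next
  case (pCons a p)
  then have "poly_tensor (pCons a p) q = pCons (smult a q) (poly_tensor p q)"
    by (simp add: poly_tensor_def map_poly_pCons)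
  with pCons.IH show ?case by (simp add: eval2_def algebra_simps)
qed

lemma eval2_poly_eval_tensor: "eval2 (poly_eval_tensor t p) x y = poly p (eval2 t x y)"
  by (induction p) (simp_all add: poly_eval_tensor_pCons poly_eval_tensor_simps eval2_def)

lemma eval2_poly_Delta: "eval2 (poly_Delta p) x y = poly p (x + y)"
  by (simp add: poly_Delta_def eval2_poly_eval_tensor eval2_add eval2_poly_tensor)

lemma eval2_poly_delta: "eval2 (poly_delta p) x y = poly p (x * y)"
  by (simp add: poly_delta_def eval2_poly_eval_tensor eval2_poly_tensor)

text \<open>
  Apply \<open>poly_eqI_of_nat\<close> first to the outer variable, over the integral domain $\mathbf{Q}[Y]$ of
  coefficients, in which \<open>of_nat k\<close> is the constant polynomial $k$, and then to the inner one.
\<close>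

lemma eval2_eqI:
  assumes "\<And>k l. k \<ge> 1 \<Longrightarrow> l \<ge> 1 \<Longrightarrow> eval2 S (of_nat k) (of_nat l) = eval2 T (of_nat k) (of_nat l)"
  shows "S = T"
proof (rule poly_eqI_of_nat)
  fix k :: nat assume "k \<ge> 1"
  then show "poly S (of_nat k) = poly T (of_nat k)"
    using assms by (intro poly_eqI_of_nat) (simp add: eval2_def of_nat_poly)
qed


section \<open>Linear maps out of a space with a basis\<close>

lemma linear_eq_linear_extension:
  assumes "Vector_Spaces.linear pm_scale scale f"
  shows "f x = linear_extension scale (\<lambda>a. f (basis a)) x"
proof -
  interpret Vector_Spaces.linear pm_scale scale f by fact
  have "x = (\<Sum>a\<in>Poly_Mapping.keys x. pm_scale (Poly_Mapping.lookup x a) (basis a))"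
  proof (rule poly_mapping_eqI)
    fix i
    show "Poly_Mapping.lookup x i = Poly_Mapping.lookup
        (\<Sum>a\<in>Poly_Mapping.keys x. pm_scale (Poly_Mapping.lookup x a) (basis a)) i"
      by (simp add: lookup_sum lookup_pm_scale basis_def lookup_single when_def if_distrib
          in_keys_iff cong: if_cong)
  qed
  then have "f x = f (\<Sum>a\<in>Poly_Mapping.keys x. pm_scale (Poly_Mapping.lookup x a) (basis a))"
    by simp
  then show ?thesis by (simp add: linear_extension_def sum scale)
qed

lemma linear_eqI:
  assumes "Vector_Spaces.linear pm_scale scale f" "Vector_Spaces.linear pm_scale scale g"
    and "\<And>a. f (basis a) = g (basis a)"
  shows "f x = g x"
  unfolding linear_eq_linear_extension[OF assms(1), of x] linear_eq_linear_extension[OF assms(2), of x]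
  by (simp only: assms(3))

lemma pm_scale_mult: "pm_scale q x * y = pm_scale q (x * y)" "x * pm_scale q y = pm_scale q (x * y)"
  for x y :: "'a::comm_monoid_add \<Rightarrow>\<^sub>0 rat"
proof -
  have *: "pm_scale q x = Poly_Mapping.single 0 q * x" for x :: "'a \<Rightarrow>\<^sub>0 rat"
    unfolding pm_scale_def by (rule mult_map_scale_conv_mult)
  show "pm_scale q x * y = pm_scale q (x * y)" "x * pm_scale q y = pm_scale q (x * y)"
    by (simp_all add: * mult_ac)
qed

lemma vector_space_tensor_scale: "vector_space tensor_scale"
  by unfold_locales (auto simp: tensor_scale_def smult_add_right smult_add_left[symmetric] mult.commute simp flip: one_pCons)

lemma vector_space_rat: "vector_space ((*) :: rat \<Rightarrow> rat \<Rightarrow> rat)"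
  by standard (simp_all add: algebra_simps)

text \<open>
  Both sides of the conclusion are bilinear, so that it suffices to compare them on basis elements.
\<close>

lemma multiplicative_if_basis:
  fixes f :: "('a::comm_monoid_add \<Rightarrow>\<^sub>0 rat) \<Rightarrow> 'b::comm_ring_1"
  assumes f: "Vector_Spaces.linear pm_scale scale f"
    and scale: "\<And>q u v. scale q u * v = scale q (u * v)"
    and basis: "\<And>a b. f (basis (a + b)) = f (basis a) * f (basis b)"
  shows "f (x * y) = f x * f y"
proof -
  have W: "vector_space scale" and
    lin: "f (u + v) = f u + f v" "f (pm_scale q u) = scale q (f u)" for u v q
    using f by (simp_all add: Vector_Spaces.linear_iff)
  have scale': "u * scale q v = scale q (u * v)" for u v q
    using scale[of q v u] by (simp add: mult.commute)
  have *: "f (basis a * y) = f (basis a) * f y" for a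
  proof (rule linear_eqI[of scale "\<lambda>y. f (basis a * y)" "\<lambda>y. f (basis a) * f y"])
    show "Vector_Spaces.linear pm_scale scale (\<lambda>y. f (basis a * y))"
      "Vector_Spaces.linear pm_scale scale (\<lambda>y. f (basis a) * f y)"
      unfolding Vector_Spaces.linear_iff
      by (simp_all add: vector_space_pm_scale W lin pm_scale_mult distrib_left scale')
    show "f (basis a * basis b) = f (basis a) * f (basis b)" for b
      by (simp add: basis basis_mult)
  qed
  show ?thesis
  proof (rule linear_eqI[of scale "\<lambda>x. f (x * y)" "\<lambda>x. f x * f y"])
    show "Vector_Spaces.linear pm_scale scale (\<lambda>x. f (x * y))"
      "Vector_Spaces.linear pm_scale scale (\<lambda>x. f x * f y)"
      unfolding Vector_Spaces.linear_iff
      by (simp_all add: vector_space_pm_scale W lin pm_scale_mult distrib_right scale)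
  qed (rule *)
qed

lemma linear_tensor_square: "Vector_Spaces.linear pm_scale tensor_scale (tensor_square \<phi>)"
  unfolding tensor_square_def by (rule linear_linear_extension[OF vector_space_tensor_scale])

lemma tensor_square_sum_basis:
  "tensor_square \<phi> (\<Sum>i\<in>A. basis (a i, b i)) =
     (\<Sum>i\<in>A. poly_tensor (\<phi> (basis (a i))) (\<phi> (basis (b i))))"
proof -
  interpret Vector_Spaces.linear pm_scale tensor_scale "tensor_square \<phi>"
    by (rule linear_tensor_square)
  have "tensor_square \<phi> (basis (c, d)) = poly_tensor (\<phi> (basis c)) (\<phi> (basis d))" for c d
    unfolding tensor_square_def by (subst linear_extension_basis) (auto simp: tensor_scale_def simp flip: one_pCons)
  then show ?thesis by (simp add: sum)
qed


section \<open>Numbers of proper colourings\<close>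

text \<open>
  Proper colourings with colours in an arbitrary set: disjoint sums and products of colour sets are
  what turns the two coproducts of $\mathbf{Q}[X]$ into statements about colourings.
\<close>

definition colourings :: "'v graph \<Rightarrow> 'c set \<Rightarrow> ('v \<Rightarrow> 'c) set" where
  "colourings G C = {f \<in> verts G \<rightarrow>\<^sub>E C. \<forall>x y. {x, y} \<in> edges G \<longrightarrow> f x \<noteq> f y}"

lemma is_graph_edge_verts: "is_graph G \<Longrightarrow> {x, y} \<in> edges G \<Longrightarrow> x \<in> verts G \<and> y \<in> verts G \<and> x \<noteq> y"
  by (auto simp: is_graph_def)

lemma finite_colourings: "is_graph G \<Longrightarrow> finite C \<Longrightarrow> finite (colourings G C)"
  unfolding colourings_def is_graph_def
  by (rule finite_subset[of _ "verts G \<rightarrow>\<^sub>E C"]) (auto intro: finite_PiE)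

lemma card_colourings_inj_le:
  assumes G: "is_graph G" and "finite D" and h: "inj_on h C" "h ` C \<subseteq> D"
  shows "card (colourings G C) \<le> card (colourings G D)"
proof (rule card_inj_on_le)
  show "inj_on (\<lambda>f. restrict (h \<circ> f) (verts G)) (colourings G C)"
  proof (rule inj_onI)
    fix f g assume f: "f \<in> colourings G C" and g: "g \<in> colourings G C"
      and eq: "restrict (h \<circ> f) (verts G) = restrict (h \<circ> g) (verts G)"
    have fg: "f \<in> verts G \<rightarrow>\<^sub>E C" "g \<in> verts G \<rightarrow>\<^sub>E C" using f g by (auto simp: colourings_def)
    show "f = g"
    proof (rule PiE_ext[OF fg])
      fix x assume x: "x \<in> verts G"
      then have "h (f x) = h (g x)" using fun_cong[OF eq, of x] by simp
      then show "f x = g x" using h(1) PiE_mem[OF fg(1) x] PiE_mem[OF fg(2) x] by (meson inj_onD)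
    qed
  qed
  show "(\<lambda>f. restrict (h \<circ> f) (verts G)) ` colourings G C \<subseteq> colourings G D"
  proof (rule image_subsetI)
    fix f assume "f \<in> colourings G C"
    then have f: "f \<in> verts G \<rightarrow>\<^sub>E C" "\<And>x y. {x, y} \<in> edges G \<Longrightarrow> f x \<noteq> f y"
      by (auto simp: colourings_def)
    have mem: "f x \<in> C" if "x \<in> verts G" for x using PiE_mem[OF f(1) that] .
    have "h (f x) \<noteq> h (f y)" if "{x, y} \<in> edges G" for x y
      using f(2)[OF that] mem is_graph_edge_verts[OF G that] h(1) by (meson inj_onD)
    then show "restrict (h \<circ> f) (verts G) \<in> colourings G D"
      using mem h(2) is_graph_edge_verts[OF G] by (auto simp: colourings_def)
  qed
qed (rule finite_colourings[OF G \<open>finite D\<close>])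

lemma card_colourings:
  assumes "is_graph G" "finite C"
  shows "card (colourings G C) = card (proper_colourings G (card C))"
proof -
  have "\<exists>h. bij_betw h C {1..card C}"
    using assms(2) by (intro finite_same_card_bij) auto
  then obtain h where h: "bij_betw h C {1..card C}" ..
  have "card (colourings G C) = card (colourings G {1..card C})"
    using card_colourings_inj_le[OF assms(1), of "{1..card C}" h C]
      card_colourings_inj_le[OF assms(1,2), of "inv_into C h" "{1..card C}"]
      h bij_betw_inv_into[OF h] by (auto simp: bij_betw_def intro: order_antisym)
  then show ?thesis by (simp add: colourings_def proper_colourings_def)
qed

text \<open>
  Sorting colourings by the set of colours that they use writes the number of proper
  \<open>k\<close>-colourings as a combination of binomial coefficients of \<open>k\<close>. The same formula holds for the
  polynomial at every argument, and this yields its value at $0$, a point at which the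
  definition does not prescribe it.
\<close>

lemma poly_chromatic_polynomial_gbinomial:
  assumes "is_graph G"
  shows "poly (chromatic_polynomial G) x =
    (\<Sum>j\<le>card (verts G). of_nat (card {f \<in> proper_colourings G j. f ` verts G = {1..j}}) * (x gchoose j))"
proof -
  let ?s = "\<lambda>j. of_nat (card {f \<in> proper_colourings G j. f ` verts G = {1..j}}) :: rat"
  define B :: "nat \<Rightarrow> rat poly" where
    "B j = smult (1 / fact j) (\<Prod>i<j. [:- of_nat i, 1:])" for j
  have B: "poly (B j) x = x gchoose j" for j x
    by (simp add: B_def poly_prod gbinomial_prod_rev atLeast0LessThan)
  have "chromatic_polynomial G = (\<Sum>j\<le>card (verts G). smult (?s j) (B j))"
  proof (rule poly_eqI_of_nat)
    fix k :: nat assume "k \<ge> 1"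
    then show "poly (chromatic_polynomial G) (of_nat k) =
        poly (\<Sum>j\<le>card (verts G). smult (?s j) (B j)) (of_nat k)"
      by (simp add: poly_chromatic_polynomial[OF assms] card_proper_colourings[OF assms, of k]
          poly_sum B binomial_gbinomial)
  qed
  then show ?thesis by (simp add: poly_sum B)
qed

lemma poly_chromatic_polynomial_card:
  assumes "is_graph G" "finite C"
  shows "poly (chromatic_polynomial G) (of_nat (card C)) = of_nat (card (colourings G C))"
  unfolding card_colourings[OF assms] poly_chromatic_polynomial_gbinomial[OF assms(1)]
  by (simp add: card_proper_colourings[OF assms(1), of "card C"] binomial_gbinomial)

lemma poly_chromatic_polynomial_of_nat:
  assumes "is_graph G"
  shows "poly (chromatic_polynomial G) (of_nat k) = of_nat (card (colourings G {..<k}))"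
  using poly_chromatic_polynomial_card[OF assms, of "{..<k}"] by simp

lemma poly_chromatic_polynomial_0:
  assumes "is_graph G"
  shows "poly (chromatic_polynomial G) 0 = (if verts G = {} then 1 else 0)"
proof -
  have "colourings G ({} :: nat set) = (if verts G = {} then {\<lambda>_. undefined} else {})"
    using is_graph_edge_verts[OF assms] by (auto simp: colourings_def PiE_eq_empty_iff)
  then show ?thesis using poly_chromatic_polynomial_card[OF assms, of "{} :: nat set"] by simp
qed

lemma poly_chromatic_polynomial_1:
  assumes "is_graph G"
  shows "poly (chromatic_polynomial G) 1 = (if edges G = {} then 1 else 0)"
proof -
  have eq: "colourings G {()} = (if edges G = {} then {restrict (\<lambda>_. ()) (verts G)} else {})"
    using is_graph_edgeE[OF assms] by (auto simp: colourings_def)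
  show ?thesis using poly_chromatic_polynomial_card[OF assms, of "{()}"] eq by simp
qed

lemma edges_disjoint_union_iff:
  fixes G :: "'a graph" and H :: "'b graph"
  shows "{Inl x, Inl y} \<in> edges (disjoint_union G H) \<longleftrightarrow> {x, y} \<in> edges G"
    "{Inr u, Inr v} \<in> edges (disjoint_union G H) \<longleftrightarrow> {u, v} \<in> edges H"
    "{Inl x, Inr v} \<notin> edges (disjoint_union G H)"
    "{Inr u, Inl y} \<notin> edges (disjoint_union G H)"
proof -
  have Inl: "Inl ` e \<in> (\<lambda>e. (Inl :: 'a \<Rightarrow> 'a + 'b) ` e) ` edges G \<longleftrightarrow> e \<in> edges G" for e
    by (auto simp: inj_image_eq_iff)
  have Inr: "Inr ` e \<in> (\<lambda>e. (Inr :: 'b \<Rightarrow> 'a + 'b) ` e) ` edges H \<longleftrightarrow> e \<in> edges H" for e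
    by (auto simp: inj_image_eq_iff)
  from Inl[of "{x, y}"] Inr[of "{u, v}"] show "{Inl x, Inl y} \<in> edges (disjoint_union G H) \<longleftrightarrow> {x, y} \<in> edges G"
    "{Inr u, Inr v} \<in> edges (disjoint_union G H) \<longleftrightarrow> {u, v} \<in> edges H"
    by (auto simp: disjoint_union_def)
qed (auto simp: disjoint_union_def)

lemma card_colourings_disjoint_union:
  "card (colourings (disjoint_union G H) C) = card (colourings G C) * card (colourings H C)"
proof -
  have "bij_betw (\<lambda>f. (f \<circ> Inl, f \<circ> Inr)) (colourings (disjoint_union G H) C)
          (colourings G C \<times> colourings H C)"
  proof (rule bij_betw_byWitness[where f' = "\<lambda>(a, b). case_sum a b"])
    have V: "verts (disjoint_union G H) = verts G <+> verts H"
      by (simp add: disjoint_union_def)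
    show "(\<lambda>f. (f \<circ> Inl, f \<circ> Inr)) ` colourings (disjoint_union G H) C
        \<subseteq> colourings G C \<times> colourings H C"
      by (auto simp: colourings_def V PiE_iff extensional_def edges_disjoint_union_iff)
    show "(\<lambda>(a, b). case_sum a b) ` (colourings G C \<times> colourings H C)
        \<subseteq> colourings (disjoint_union G H) C"
      by (auto simp: colourings_def V PiE_iff extensional_def edges_disjoint_union_iff
          split: sum.splits)
  qed (auto simp: fun_eq_iff split: sum.splits)
  then show ?thesis by (simp add: bij_betw_same_card card_cartesian_product)
qed

lemma colourings_induced_iff:
  "f \<in> colourings (induced G I) C \<longleftrightarrow>
     f \<in> I \<rightarrow>\<^sub>E C \<and> (\<forall>x\<in>I. \<forall>y\<in>I. {x, y} \<in> edges G \<longrightarrow> f x \<noteq> f y)"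
  by (auto simp: colourings_def induced_def)

text \<open>
  A colouring with colours in a disjoint sum \<open>A <+> B\<close> splits the vertices into the set \<open>I\<close> of
  those with a colour in \<open>A\<close> and its complement. Edges between the two parts impose no condition,
  since their ends have colours of different kinds, so it remains to choose a proper colouring of
  each of the two induced subgraphs.
\<close>

lemma card_colourings_Plus:
  assumes G: "is_graph G" and fin: "finite A" "finite B"
  shows "card (colourings G (A <+> B)) =
    (\<Sum>I\<in>Pow (verts G). card (colourings (induced G I) A) * card (colourings (induced G (verts G - I)) B))"
proof -
  let ?V = "verts G"
  let ?S = "SIGMA I:Pow ?V. colourings (induced G I) A \<times> colourings (induced G (?V - I)) B"
  have finS: "finite (colourings (induced G I) A)" "finite (colourings (induced G (?V - I)) B)"
    if "I \<in> Pow ?V" for I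
    using that fin by (auto intro!: finite_colourings is_graph_induced[OF G])
  define merge :: "'a set \<times> ('a \<Rightarrow> 'b) \<times> ('a \<Rightarrow> 'c) \<Rightarrow> 'a \<Rightarrow> 'b + 'c" where
    "merge = (\<lambda>(I, a, b). restrict (\<lambda>x. if x \<in> I then Inl (a x) else Inr (b x)) ?V)"
  define split :: "('a \<Rightarrow> 'b + 'c) \<Rightarrow> 'a set \<times> ('a \<Rightarrow> 'b) \<times> ('a \<Rightarrow> 'c)" where
    "split f = (let I = {x \<in> ?V. isl (f x)} in (I, restrict (projl \<circ> f) I, restrict (projr \<circ> f) (?V - I)))" for f
  have "bij_betw merge ?S (colourings G (A <+> B))"
  proof (rule bij_betw_byWitness[where f' = split])
    show "\<forall>p\<in>?S. split (merge p) = p"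
    proof clarify
      fix I a b assume "I \<subseteq> ?V" "a \<in> colourings (induced G I) A"
        "b \<in> colourings (induced G (?V - I)) B"
      then have *: "{x \<in> ?V. isl (merge (I, a, b) x)} = I" "a \<in> extensional I" "b \<in> extensional (?V - I)"
        by (auto simp: merge_def colourings_induced_iff PiE_iff split: if_splits)
      then show "split (merge (I, a, b)) = (I, a, b)"
        using \<open>I \<subseteq> ?V\<close> by (auto simp: split_def Let_def merge_def extensional_def fun_eq_iff)
    qed
    show "\<forall>f\<in>colourings G (A <+> B). merge (split f) = f"
      by (auto simp: merge_def split_def Let_def colourings_def PiE_iff extensional_def fun_eq_iff)
    show "merge ` ?S \<subseteq> colourings G (A <+> B)"
      using is_graph_edge_verts[OF G]
      by (auto simp: merge_def colourings_induced_iff colourings_def[of G] PiE_iff split: if_splits)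
    show "split ` colourings G (A <+> B) \<subseteq> ?S"
    proof (rule image_subsetI)
      fix f assume f: "f \<in> colourings G (A <+> B)"
      have "f x \<in> A <+> B" if "x \<in> ?V" for x using f that by (auto simp: colourings_def)
      then have mem: "if isl (f x) then projl (f x) \<in> A else projr (f x) \<in> B" if "x \<in> ?V" for x
        using that by fastforce
      have ne: "f x \<noteq> f y" if "{x, y} \<in> edges G" for x y using f that by (auto simp: colourings_def)
      have "projl (f x) \<noteq> projl (f y)" if "{x, y} \<in> edges G" "isl (f x)" "isl (f y)" for x y
        using ne[OF that(1)] that(2,3) by (metis sum.collapse(1))
      moreover have "projr (f x) \<noteq> projr (f y)" if "{x, y} \<in> edges G" "\<not> isl (f x)" "\<not> isl (f y)" for x y
        using ne[OF that(1)] that(2,3) by (metis sum.collapse(2))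
      ultimately show "split f \<in> ?S"
        using mem by (auto simp: split_def Let_def colourings_induced_iff split: if_splits)
    qed
  qed
  then have "card (colourings G (A <+> B)) = card ?S" by (simp add: bij_betw_same_card)
  also have "\<dots> = (\<Sum>I\<in>Pow ?V. card (colourings (induced G I) A \<times> colourings (induced G (?V - I)) B))"
    using G finS by (intro card_SigmaI) (auto simp: is_graph_def)
  finally show ?thesis by (simp add: card_cartesian_product)
qed


section \<open>Pairs as colours and contractions\<close>

text \<open>
  The classes are the connected components of the graph formed by the edges whose ends have the same
  colour. The intersection discards the pairs \<open>(x, x)\<close> with \<open>x\<close> outside the graph, which the
  reflexive closure contains.
\<close>

definition monochromatic_rel :: "'v graph \<Rightarrow> ('v \<Rightarrow> 'c) \<Rightarrow> ('v \<times> 'v) set" where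
  "monochromatic_rel G g =
     {(u, v). {u, v} \<in> edges G \<and> g u = g v}\<^sup>* \<inter> verts G \<times> verts G"

lemma monochromatic_rel_colour: "(x, y) \<in> monochromatic_rel G g \<Longrightarrow> g x = g y"
proof -
  assume "(x, y) \<in> monochromatic_rel G g"
  then have "(x, y) \<in> {(u, v). {u, v} \<in> edges G \<and> g u = g v}\<^sup>*"
    by (simp add: monochromatic_rel_def)
  then show ?thesis by induction auto
qed

lemma equiv_monochromatic_rel: "equiv (verts G) (monochromatic_rel G g)"
proof (rule equivI)
  have "sym {(u, v). {u, v} \<in> edges G \<and> g u = g v}"
    by (auto simp: sym_def insert_commute)
  then show "sym (monochromatic_rel G g)"
    unfolding monochromatic_rel_def by (intro sym_Int sym_rtrancl) (auto simp: sym_def)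
  show "trans (monochromatic_rel G g)"
    unfolding monochromatic_rel_def by (intro trans_Int trans_rtrancl) (auto simp: trans_def)
qed (auto simp: monochromatic_rel_def refl_on_def)

text \<open>
  A path of constant colour from one vertex of a class to another never leaves this class, so
  that it is also a path of the subgraph induced on the class.
\<close>

lemma monochromatic_rel_in_contractions:
  assumes G: "is_graph G"
  shows "monochromatic_rel G g \<in> contractions G"
proof -
  let ?R = "monochromatic_rel G g"
  note eq = equiv_monochromatic_rel[of G g]
  have "connected_graph (induced G c)" if c: "c \<in> verts G // ?R" for c
    unfolding connected_graph_def
  proof (intro conjI ballI)
    show "verts (induced G c) \<noteq> {}"
      using in_quotient_imp_non_empty[OF eq c] by (simp add: induced_def)
    fix x y assume "x \<in> verts (induced G c)" "y \<in> verts (induced G c)"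
    then have xy: "x \<in> c" "y \<in> c" by (simp_all add: induced_def)
    then have "(x, y) \<in> ?R" using in_quotient_imp_in_rel[OF eq c] by simp
    then have "x \<in> verts G" "(x, y) \<in> {(u, v). {u, v} \<in> edges G \<and> g u = g v}\<^sup>*"
      by (auto simp: monochromatic_rel_def)
    from this(2) have "(x, y) \<in> {(u, v). {u, v} \<in> edges (induced G c)}\<^sup>* \<and> y \<in> c"
    proof induction
      case (step y z)
      then have "(y, z) \<in> ?R"
        using is_graph_edge_verts[OF G, of y z] by (auto simp: monochromatic_rel_def)
      then have "z \<in> c" using step.IH in_quotient_imp_closed[OF eq c] by blast
      then have "(y, z) \<in> {(u, v). {u, v} \<in> edges (induced G c)}"
        using step by (auto simp: induced_def)
      then show ?case using step.IH \<open>z \<in> c\<close> by (auto intro: rtrancl_into_rtrancl)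
    qed (simp add: xy)
    then show "(x, y) \<in> {(u, v). {u, v} \<in> edges (induced G c)}\<^sup>*" ..
  qed
  then show ?thesis using eq by (simp add: contractions_def)
qed

text \<open>
  This recovers \<open>r\<close> from the colouring \<open>g\<close> of the vertices that a proper colouring of \<open>G / r\<close>
  induces. Adjacent vertices in different classes lie in adjacent classes, hence have different
  colours, so a monochromatic path stays in one class; and a class is connected and
  monochromatic, so any two of its vertices are joined by such a path.
\<close>

lemma monochromatic_rel_contract:
  assumes G: "is_graph G" and r: "r \<in> contractions G" and a: "a \<in> colourings (contract_graph G r) A"
    and g: "\<And>x. x \<in> verts G \<Longrightarrow> g x = a (r `` {x})"
  shows "monochromatic_rel G g = r"
proof (intro equalityI subrelI)
  have eq: "equiv (verts G) r" and con: "\<And>c. c \<in> verts G // r \<Longrightarrow> connected_graph (induced G c)"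
    using r by (auto simp: contractions_def)
  have sub: "r \<subseteq> verts G \<times> verts G" using eq by (simp add: equiv_def)
  fix x y
  have edge: "(u, v) \<in> r" if "{u, v} \<in> edges G" "g u = g v" for u v
  proof (rule ccontr)
    assume "(u, v) \<notin> r"
    have V: "u \<in> verts G" "v \<in> verts G" using is_graph_edge_verts[OF G that(1)] by auto
    have "r `` {u} \<noteq> r `` {v}" using \<open>(u, v) \<notin> r\<close> eq_equiv_class[OF _ eq V(2)] by blast
    moreover have "u \<in> r `` {u}" "v \<in> r `` {v}" using equiv_class_self[OF eq] V by auto
    ultimately have "{r `` {u}, r `` {v}} \<in> edges (contract_graph G r)"
      unfolding contract_graph_def snd_conv using V that(1) quotientI[of _ "verts G" r] by blast
    then have "a (r `` {u}) \<noteq> a (r `` {v})" using a by (simp add: colourings_def)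
    then show False using that(2) g V by simp
  qed
  show "(x, y) \<in> r" if "(x, y) \<in> monochromatic_rel G g"
  proof -
    from that have "(x, y) \<in> {(u, v). {u, v} \<in> edges G \<and> g u = g v}\<^sup>*" "x \<in> verts G"
      by (auto simp: monochromatic_rel_def)
    then show ?thesis
    proof induction
      case base
      then show ?case using eq by (meson equivE refl_onD)
    next
      case (step y z)
      then show ?case using edge[of y z] eq by (auto elim!: equivE dest: transD)
    qed
  qed
  show "(x, y) \<in> monochromatic_rel G g" if "(x, y) \<in> r"
  proof -
    have V: "x \<in> verts G" "y \<in> verts G" using that sub by auto
    let ?c = "r `` {x}"
    have c: "?c \<in> verts G // r" using V by (simp add: quotientI)
    have "x \<in> verts (induced G ?c)" "y \<in> verts (induced G ?c)"
      using that equiv_class_self[OF eq V(1)] by (auto simp: induced_def)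
    then have "(x, y) \<in> {(u, v). {u, v} \<in> edges (induced G ?c)}\<^sup>*"
      using con[OF c] by (simp add: connected_graph_def)
    moreover have "{(u, v). {u, v} \<in> edges (induced G ?c)} \<subseteq> {(u, v). {u, v} \<in> edges G \<and> g u = g v}"
    proof clarify
      fix u v assume "{u, v} \<in> edges (induced G ?c)"
      then have uv: "{u, v} \<in> edges G" "(x, u) \<in> r" "(x, v) \<in> r" by (auto simp: induced_def)
      then have "r `` {u} = r `` {v}" using equiv_class_eq[OF eq] by blast
      then show "{u, v} \<in> edges G \<and> g u = g v" using uv g is_graph_edge_verts[OF G uv(1)] by simp
    qed
    ultimately show ?thesis using V rtrancl_mono by (auto simp: monochromatic_rel_def)
  qed
qed

lemma finite_contractions: "is_graph G \<Longrightarrow> finite (contractions G)"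
  by (rule finite_subset[of _ "Pow (verts G \<times> verts G)"])
     (auto simp: contractions_def equiv_def is_graph_def)

lemma contract_graph_edgeE:
  assumes "{c, c'} \<in> edges (contract_graph G r)"
  obtains x y where "c \<in> verts G // r" "c' \<in> verts G // r" "c \<noteq> c'"
    "x \<in> c" "y \<in> c'" "{x, y} \<in> edges G"
proof -
  from assms obtain d d' u v where d: "d \<in> verts G // r" "d' \<in> verts G // r" "d \<noteq> d'"
    and uv: "u \<in> d" "v \<in> d'" "{u, v} \<in> edges G" and "{c, c'} = {d, d'}"
    unfolding contract_graph_def snd_conv by blast
  then consider "c = d" "c' = d'" | "c = d'" "c' = d" by (auto simp: doubleton_eq_iff)
  then show ?thesis
  proof cases
    case 1
    with d uv that[of u v] show ?thesis by simp
  next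
    case 2
    with d uv that[of v u] show ?thesis by (simp add: insert_commute)
  qed
qed

text \<open>
  In a proper colouring \<open>f\<close> with colours in \<open>A \<times> B\<close>, the first components need not form a
  proper colouring. Let \<open>r\<close> be the relation of being joined by a path on which the first component
  is constant. Then the first components form a proper colouring of \<open>G / r\<close>, while the second
  components must distinguish exactly the ends of those edges that lie inside a class, hence form a
  proper colouring of \<open>G | r\<close>. Conversely a triple of \<open>r\<close> and two such colourings yields a proper
  colouring of \<open>G\<close>, and \<open>monochromatic_rel_contract\<close> shows that \<open>r\<close>, hence the
  triple, can be read off from it.
\<close>

lemma card_colourings_Times:
  assumes G: "is_graph G" and fin: "finite A" "finite B"
  shows "card (colourings G (A \<times> B)) =
    (\<Sum>r\<in>contractions G. card (colourings (contract_graph G r) A) * card (colourings (restrict_graph G r) B))"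
proof -
  let ?V = "verts G"
  let ?S = "SIGMA r:contractions G. colourings (contract_graph G r) A \<times> colourings (restrict_graph G r) B"
  define merge :: "('a \<times> 'a) set \<times> ('a set \<Rightarrow> 'b) \<times> ('a \<Rightarrow> 'c) \<Rightarrow> 'a \<Rightarrow> 'b \<times> 'c" where
    "merge = (\<lambda>(r, a, b). restrict (\<lambda>x. (a (r `` {x}), b x)) ?V)"
  have vc: "verts (contract_graph G r) = ?V // r" "verts (restrict_graph G r) = ?V" for r
    by (simp_all add: contract_graph_def restrict_graph_def)
  have "bij_betw merge ?S (colourings G (A \<times> B))"
    unfolding bij_betw_def
  proof (intro conjI equalityI)
    show "inj_on merge ?S"
    proof (rule inj_onI)
      fix p p' assume "p \<in> ?S" "p' \<in> ?S" and "merge p = merge p'"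
      moreover obtain r a b r' a' b' where pp: "p = (r, a, b)" "p' = (r', a', b')"
        by (metis prod_cases3)
      ultimately have r: "r \<in> contractions G" "a \<in> colourings (contract_graph G r) A"
          "b \<in> colourings (restrict_graph G r) B"
        and r': "r' \<in> contractions G" "a' \<in> colourings (contract_graph G r') A"
          "b' \<in> colourings (restrict_graph G r') B"
        and eq: "merge (r, a, b) = merge (r', a', b')"
        by auto
      have vals: "a (r `` {x}) = a' (r' `` {x})" "b x = b' x" if "x \<in> ?V" for x
        using fun_cong[OF eq, of x] that by (simp_all add: merge_def)
      \<comment> \<open>both relations are the monochromatic relation of the first component of the colouring\<close>
      have "r = r'"
        using monochromatic_rel_contract[OF G r(1,2), of "\<lambda>x. a (r `` {x})"]
          monochromatic_rel_contract[OF G r'(1,2), of "\<lambda>x. a (r `` {x})"] vals by simp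
      moreover have "a = a'"
      proof (rule PiE_ext)
        show "a \<in> ?V // r \<rightarrow>\<^sub>E A" "a' \<in> ?V // r \<rightarrow>\<^sub>E A"
          using r(2) r'(2) \<open>r = r'\<close> by (auto simp: colourings_def vc)
        show "a c = a' c" if "c \<in> ?V // r" for c
          using that vals \<open>r = r'\<close> by (auto elim!: quotientE)
      qed
      moreover have "b = b'"
      proof (rule PiE_ext)
        show "b \<in> ?V \<rightarrow>\<^sub>E B" "b' \<in> ?V \<rightarrow>\<^sub>E B"
          using r(3) r'(3) by (auto simp: colourings_def vc)
        show "b x = b' x" if "x \<in> ?V" for x using vals(2)[OF that] .
      qed
      ultimately show "p = p'" by (simp add: pp)
    qed
    show "merge ` ?S \<subseteq> colourings G (A \<times> B)"
    proof (rule image_subsetI, clarify)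
      fix r a b
      assume r: "r \<in> contractions G" and a: "a \<in> colourings (contract_graph G r) A"
        and b: "b \<in> colourings (restrict_graph G r) B"
      have "merge (r, a, b) \<in> ?V \<rightarrow>\<^sub>E A \<times> B"
        using a b quotientI[of _ ?V r] by (auto simp: merge_def colourings_def vc)
      moreover have "merge (r, a, b) x \<noteq> merge (r, a, b) y" if xy: "{x, y} \<in> edges G" for x y
      proof
        assume m: "merge (r, a, b) x = merge (r, a, b) y"
        have V: "x \<in> ?V" "y \<in> ?V" using is_graph_edge_verts[OF G xy] by auto
        with m have ab: "a (r `` {x}) = a (r `` {y})" "b x = b y" by (simp_all add: merge_def)
        then have "(x, y) \<in> monochromatic_rel G (\<lambda>x. a (r `` {x}))"
          using V xy by (auto simp: monochromatic_rel_def)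
        then have "(x, y) \<in> r" using monochromatic_rel_contract[OF G r a] by simp
        then have "{x, y} \<in> edges (restrict_graph G r)" using xy by (auto simp: restrict_graph_def)
        then show False using b ab(2) by (auto simp: colourings_def)
      qed
      ultimately show "merge (r, a, b) \<in> colourings G (A \<times> B)" by (simp add: colourings_def)
    qed
    show "colourings G (A \<times> B) \<subseteq> merge ` ?S"
    proof
      fix f assume f: "f \<in> colourings G (A \<times> B)"
      have mem: "fst (f x) \<in> A" "snd (f x) \<in> B" if "x \<in> ?V" for x
        using f that by (auto simp: colourings_def PiE_iff mem_Times_iff)
      have ne: "f x \<noteq> f y" if "{x, y} \<in> edges G" for x y using f that by (auto simp: colourings_def)
      \<comment> \<open>the colour of a class is the first component at any of its vertices\<close>
      define g where "g = fst \<circ> f"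
      define r where "r = monochromatic_rel G g"
      define a where "a = restrict (\<lambda>c. g (SOME x. x \<in> c)) (?V // r)"
      define b where "b = restrict (snd \<circ> f) ?V"
      have eq: "equiv ?V r" unfolding r_def by (rule equiv_monochromatic_rel)
      have colour: "g x = g y" if "(x, y) \<in> r" for x y
        using that unfolding r_def by (rule monochromatic_rel_colour)
      have some: "a c = g x" if "c \<in> ?V // r" "x \<in> c" for c x
      proof -
        have "(SOME x. x \<in> c) \<in> c" using that(2) by (rule someI)
        then have "(SOME x. x \<in> c, x) \<in> r"
          using in_quotient_imp_in_rel[OF eq that(1)] that(2) by blast
        then show ?thesis using colour that(1) by (simp add: a_def)
      qed
      have sub: "x \<in> ?V" if "c \<in> ?V // r" "x \<in> c" for c x
        using in_quotient_imp_subset[OF eq that(1)] that(2) by auto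
      have a: "a \<in> colourings (contract_graph G r) A"
      proof -
        have "a \<in> ?V // r \<rightarrow>\<^sub>E A"
        proof (rule PiE_I)
          fix c assume c: "c \<in> ?V // r"
          then obtain x where x: "x \<in> c" using in_quotient_imp_non_empty[OF eq c] by auto
          then show "a c \<in> A" using some[OF c x] mem[OF sub[OF c x]] by (auto simp: g_def)
        qed (simp add: a_def)
        moreover have "a c \<noteq> a c'" if cc: "{c, c'} \<in> edges (contract_graph G r)" for c c'
        proof -
          from cc obtain x y where c: "c \<in> ?V // r" "c' \<in> ?V // r" "c \<noteq> c'"
            and xy: "x \<in> c" "y \<in> c'" "{x, y} \<in> edges G"
            by (rule contract_graph_edgeE)
          have "g x \<noteq> g y"
          proof
            assume "g x = g y"
            then have "(x, y) \<in> r" using xy is_graph_edge_verts[OF G xy(3)]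
              by (auto simp: r_def monochromatic_rel_def)
            then show False using quotient_eqI[OF eq c(1,2) xy(1,2)] c(3) by simp
          qed
          then show ?thesis using some c xy by metis
        qed
        ultimately show ?thesis by (simp add: colourings_def vc)
      qed
      have b: "b \<in> colourings (restrict_graph G r) B"
      proof -
        have "snd (f x) \<noteq> snd (f y)" if "{x, y} \<in> edges (restrict_graph G r)" for x y
        proof -
          from that have xy: "{x, y} \<in> edges G" "(x, y) \<in> r \<or> (y, x) \<in> r"
            by (auto simp: restrict_graph_def doubleton_eq_iff insert_commute)
          then have "fst (f x) = fst (f y)" using colour[of x y] colour[of y x] by (auto simp: g_def)
          with ne[OF xy(1)] show ?thesis by (simp add: prod_eq_iff)
        qed
        moreover have "x \<in> ?V" "y \<in> ?V" if "{x, y} \<in> edges (restrict_graph G r)" for x y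
          using is_graph_edge_verts[OF is_graph_restrict[OF G] that] by (auto simp: vc)
        ultimately show ?thesis using mem by (auto simp: colourings_def vc b_def)
      qed
      have "merge (r, a, b) = f"
      proof
        fix x
        show "merge (r, a, b) x = f x"
        proof (cases "x \<in> ?V")
          case True
          then have "a (r `` {x}) = g x"
            using some[OF quotientI[OF True], of x] equiv_class_self[OF eq True] by simp
          with True show ?thesis by (simp add: merge_def b_def g_def prod_eq_iff)
        next
          case False
          have "f \<in> ?V \<rightarrow>\<^sub>E A \<times> B" using f by (simp add: colourings_def)
          then have "f x = undefined" using False by (rule PiE_arb)
          with False show ?thesis by (simp add: merge_def)
        qed
      qed
      moreover have "r \<in> contractions G"
        unfolding r_def by (rule monochromatic_rel_in_contractions[OF G])
      then have "(r, a, b) \<in> ?S" using a b by simp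
      ultimately show "f \<in> merge ` ?S" by (rule image_eqI[OF sym])
    qed
  qed
  then have "card (colourings G (A \<times> B)) = card ?S" by (simp add: bij_betw_same_card)
  also have "\<dots> = (\<Sum>r\<in>contractions G.
      card (colourings (contract_graph G r) A \<times> colourings (restrict_graph G r) B))"
    using finite_contractions[OF G] fin is_graph_contract[OF G] is_graph_restrict[OF G]
    by (intro card_SigmaI) (auto intro!: finite_cartesian_product finite_colourings)
  finally show ?thesis by (simp add: card_cartesian_product)
qed


section \<open>Identities between chromatic polynomials\<close>

lemma chromatic_polynomial_empty: "chromatic_polynomial (empty_graph :: 'v graph) = 1"
proof (rule poly_eqI_of_nat)
  fix k :: nat
  have "colourings (empty_graph :: 'v graph) {..<k} = {\<lambda>_. undefined}"
    by (auto simp: colourings_def empty_graph_def)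
  then show "poly (chromatic_polynomial (empty_graph :: 'v graph)) (of_nat k) = poly 1 (of_nat k)"
    by (simp add: poly_chromatic_polynomial_of_nat is_graph_empty)
qed

lemma chromatic_polynomial_disjoint_union:
  assumes "is_graph G" "is_graph H"
  shows "chromatic_polynomial (disjoint_union G H) = chromatic_polynomial G * chromatic_polynomial H"
  using assms
  by (intro poly_eqI_of_nat)
     (simp add: poly_chromatic_polynomial_of_nat is_graph_disjoint_union card_colourings_disjoint_union)

text \<open>
  Evaluate at $(k, l)$ and count the colourings with the $k + l$ colours of a disjoint sum.
\<close>

lemma poly_Delta_chromatic_polynomial:
  assumes G: "is_graph G"
  shows "poly_Delta (chromatic_polynomial G) =
    (\<Sum>I\<in>Pow (verts G). poly_tensor (chromatic_polynomial (induced G I))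
                                 (chromatic_polynomial (induced G (verts G - I))))"
proof (rule eval2_eqI)
  fix k l :: nat
  have "poly (chromatic_polynomial G) (of_nat (card ({..<k} <+> {..<l}))) =
      (\<Sum>I\<in>Pow (verts G). poly (chromatic_polynomial (induced G I)) (of_nat k) *
          poly (chromatic_polynomial (induced G (verts G - I))) (of_nat l))"
    using is_graph_induced[OF G]
    by (subst poly_chromatic_polynomial_card)
       (auto simp: G card_colourings_Plus poly_chromatic_polynomial_of_nat intro!: sum.cong)
  then show "eval2 (poly_Delta (chromatic_polynomial G)) (of_nat k) (of_nat l) =
      eval2 (\<Sum>I\<in>Pow (verts G). poly_tensor (chromatic_polynomial (induced G I))
               (chromatic_polynomial (induced G (verts G - I)))) (of_nat k) (of_nat l)"
    by (simp add: eval2_poly_Delta eval2_sum eval2_poly_tensor card_Plus)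
qed

text \<open>
  Evaluate at $(k, l)$ and count the colourings with the $k l$ colours of a product.
\<close>

lemma poly_delta_chromatic_polynomial:
  assumes G: "is_graph G"
  shows "poly_delta (chromatic_polynomial G) =
    (\<Sum>r\<in>contractions G. poly_tensor (chromatic_polynomial (contract_graph G r))
                                     (chromatic_polynomial (restrict_graph G r)))"
proof (rule eval2_eqI)
  fix k l :: nat
  have "poly (chromatic_polynomial G) (of_nat (card ({..<k} \<times> {..<l}))) =
      (\<Sum>r\<in>contractions G. poly (chromatic_polynomial (contract_graph G r)) (of_nat k) *
          poly (chromatic_polynomial (restrict_graph G r)) (of_nat l))"
    by (subst poly_chromatic_polynomial_card)
       (simp_all add: G card_colourings_Times poly_chromatic_polynomial_of_nat
          is_graph_contract is_graph_restrict)
  then show "eval2 (poly_delta (chromatic_polynomial G)) (of_nat k) (of_nat l) =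
      eval2 (\<Sum>r\<in>contractions G. poly_tensor (chromatic_polynomial (contract_graph G r))
               (chromatic_polynomial (restrict_graph G r))) (of_nat k) (of_nat l)"
    by (simp add: eval2_poly_delta eval2_sum eval2_poly_tensor)
qed


section \<open>The chromatic polynomial as a morphism\<close>

lemma linear_poly_eval_tensor: "Vector_Spaces.linear smult tensor_scale (poly_eval_tensor t)"
  by (simp add: Vector_Spaces.linear_iff vector_space_smult vector_space_tensor_scale
      poly_eval_tensor_add poly_eval_tensor_smult)

lemma linear_poly_coproducts:
  "Vector_Spaces.linear smult tensor_scale poly_Delta"
  "Vector_Spaces.linear smult tensor_scale poly_delta"
  unfolding poly_Delta_def poly_delta_def by (rule linear_poly_eval_tensor)+

lemma linear_poly_counits:
  "Vector_Spaces.linear smult (*) poly_eps" "Vector_Spaces.linear smult (*) poly_eps'"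
  by (simp_all add: Vector_Spaces.linear_iff vector_space_smult vector_space_rat
      poly_eps_def poly_eps'_def)

lemma linear_graph_maps:
  "Vector_Spaces.linear pm_scale pm_scale HG_Delta"
  "Vector_Spaces.linear pm_scale pm_scale HG_delta"
  "Vector_Spaces.linear pm_scale (*) HG_eps"
  "Vector_Spaces.linear pm_scale (*) HG_eps'"
  "Vector_Spaces.linear pm_scale smult P_chr"
  unfolding HG_Delta_def HG_delta_def HG_eps_def HG_eps'_def P_chr_def
  by (rule linear_linear_extension vector_space_pm_scale vector_space_rat vector_space_smult)+

lemma linear_dgraph_maps:
  "Vector_Spaces.linear pm_scale pm_scale HGD_Delta"
  "Vector_Spaces.linear pm_scale pm_scale HGD_delta"
  "Vector_Spaces.linear pm_scale (*) HGD_eps"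
  "Vector_Spaces.linear pm_scale (*) HGD_eps'"
  "Vector_Spaces.linear pm_scale pm_scale forget_decorations"
  unfolding HGD_Delta_def HGD_delta_def HGD_eps_def HGD_eps'_def forget_decorations_def
  by (rule linear_linear_extension vector_space_pm_scale vector_space_rat)+

text \<open>
  All the conditions compare linear or bilinear maps, and so may be checked on basis elements.
\<close>

lemma bialgebra_morphismI:
  assumes \<phi>: "Vector_Spaces.linear pm_scale smult \<phi>"
    and coprod\<^sub>1: "Vector_Spaces.linear pm_scale pm_scale coprod\<^sub>1"
    and coprod\<^sub>2: "Vector_Spaces.linear smult tensor_scale coprod\<^sub>2"
    and counit\<^sub>1: "Vector_Spaces.linear pm_scale (*) counit\<^sub>1"
    and counit\<^sub>2: "Vector_Spaces.linear smult (*) counit\<^sub>2"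
    and unit: "\<phi> (basis 0) = 1"
    and mult: "\<And>a b. \<phi> (basis (a + b)) = \<phi> (basis a) * \<phi> (basis b)"
    and coprod: "\<And>a. tensor_square \<phi> (coprod\<^sub>1 (basis a)) = coprod\<^sub>2 (\<phi> (basis a))"
    and counit: "\<And>a. counit\<^sub>2 (\<phi> (basis a)) = counit\<^sub>1 (basis a)"
  shows "bialgebra_morphism coprod\<^sub>1 counit\<^sub>1 coprod\<^sub>2 counit\<^sub>2 \<phi>"
  unfolding bialgebra_morphism_def
proof (intro conjI allI \<phi>)
  show "\<phi> 1 = 1" using unit by (simp add: basis_zero)
  show "\<phi> (x * y) = \<phi> x * \<phi> y" for x y
    by (rule multiplicative_if_basis[OF \<phi> _ mult]) simp
  show "tensor_square \<phi> (coprod\<^sub>1 x) = coprod\<^sub>2 (\<phi> x)" for x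
    using linear_eqI[OF Vector_Spaces.linear_compose[OF coprod\<^sub>1 linear_tensor_square]
        Vector_Spaces.linear_compose[OF \<phi> coprod\<^sub>2], of \<phi> x] coprod by simp
  show "counit\<^sub>2 (\<phi> x) = counit\<^sub>1 x" for x
    using linear_eqI[OF Vector_Spaces.linear_compose[OF \<phi> counit\<^sub>2] counit\<^sub>1, of x] counit by simp
qed

lemma gclass_cases:
  obtains G :: "nat graph" where "is_graph G" "c = graph_class G"
  using graph_rep by metis

lemma dgclass_cases:
  obtains G :: "(nat, 'd) dgraph" where "is_graph (fst G)" "c = dgraph_class G"
  using dgraph_rep by metis

lemma P_chr_mult_basis:
  "P_chr (basis 0) = 1" "P_chr (basis (a + b)) = P_chr (basis a) * P_chr (basis b)"
proof -
  show "P_chr (basis 0) = 1"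
    unfolding zero_gclass_def by (simp add: H_G_basis is_graph_empty chromatic_polynomial_empty)
  show "P_chr (basis (a + b)) = P_chr (basis a) * P_chr (basis b)"
    by (cases a rule: gclass_cases, cases b rule: gclass_cases)
       (simp add: graph_class_plus H_G_basis is_graph_disjoint_union chromatic_polynomial_disjoint_union)
qed

lemma bialgebra_morphism_Delta_P_chr: "bialgebra_morphism HG_Delta HG_eps poly_Delta poly_eps P_chr"
proof (rule bialgebra_morphismI; (rule linear_graph_maps linear_poly_coproducts linear_poly_counits P_chr_mult_basis)?)
  fix c
  obtain G :: "nat graph" where G: "is_graph G" and c: "c = graph_class G" by (rule gclass_cases)
  show "tensor_square P_chr (HG_Delta (basis c)) = poly_Delta (P_chr (basis c))"
    unfolding c H_G_basis[OF G] graph_Delta_def tensor_square_sum_basis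
    by (simp add: H_G_basis is_graph_induced[OF G] poly_Delta_chromatic_polynomial[OF G])
  show "poly_eps (P_chr (basis c)) = HG_eps (basis c)"
    by (simp add: c H_G_basis G poly_eps_def poly_chromatic_polynomial_0)
qed

lemma bialgebra_morphism_delta_P_chr: "bialgebra_morphism HG_delta HG_eps' poly_delta poly_eps' P_chr"
proof (rule bialgebra_morphismI; (rule linear_graph_maps linear_poly_coproducts linear_poly_counits P_chr_mult_basis)?)
  fix c
  obtain G :: "nat graph" where G: "is_graph G" and c: "c = graph_class G" by (rule gclass_cases)
  show "tensor_square P_chr (HG_delta (basis c)) = poly_delta (P_chr (basis c))"
    unfolding c H_G_basis[OF G] graph_delta_def tensor_square_sum_basis
    by (simp add: H_G_basis is_graph_contract[OF G] is_graph_restrict[OF G]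
        poly_delta_chromatic_polynomial[OF G])
  show "poly_eps' (P_chr (basis c)) = HG_eps' (basis c)"
    by (simp add: c H_G_basis G poly_eps'_def poly_chromatic_polynomial_1)
qed


section \<open>Forgetting decorations\<close>

lemma forget_decorations_one: "forget_decorations (1 :: 'd H_GD) = 1"
  unfolding basis_zero[symmetric] zero_dgclass_def zero_gclass_def
  by (simp add: H_GD_basis is_graph_empty_dgraph) (simp add: empty_dgraph_def)

lemma forget_decorations_mult:
  fixes x y :: "'d H_GD"
  shows "forget_decorations (x * y) = forget_decorations x * forget_decorations y"
proof (rule multiplicative_if_basis[OF linear_dgraph_maps(5)])
  show "forget_decorations (basis (a + b)) =
      forget_decorations (basis a) * forget_decorations (basis b)" for a b :: "'d dgclass"
    by (cases a rule: dgclass_cases, cases b rule: dgclass_cases)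
       (simp add: dgraph_class_plus H_GD_basis is_graph_ddisjoint_union basis_mult
          graph_class_plus, simp add: ddisjoint_union_def)
qed (rule pm_scale_mult)

text \<open>
  Taking induced subgraphs, contracting and restricting commute with forgetting decorations. The
  premises \<open>coprodD\<close> and \<open>counitD\<close> capture this compatibility in a form that serves both coproducts.
\<close>

lemma bialgebra_morphism_forget_decorations:
  fixes \<phi> :: "H_G \<Rightarrow> rat poly"
  assumes \<phi>: "bialgebra_morphism coprod\<^sub>1 counit\<^sub>1 coprod\<^sub>2 counit\<^sub>2 \<phi>"
    and lin: "Vector_Spaces.linear pm_scale pm_scale coprod\<^sub>1" "Vector_Spaces.linear pm_scale (*) counit\<^sub>1"
      "Vector_Spaces.linear pm_scale pm_scale coprodD" "Vector_Spaces.linear pm_scale (*) counitD"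
    and coprodD: "\<And>G :: (nat, 'd) dgraph. is_graph (fst G) \<Longrightarrow>
      tensor_square (\<phi> \<circ> forget_decorations) (coprodD (basis (dgraph_class G))) =
      tensor_square \<phi> (coprod\<^sub>1 (basis (graph_class (fst G))))"
    and counitD: "\<And>G :: (nat, 'd) dgraph. is_graph (fst G) \<Longrightarrow>
      counitD (basis (dgraph_class G)) = counit\<^sub>1 (basis (graph_class (fst G)))"
  shows "bialgebra_morphism coprodD counitD coprod\<^sub>2 counit\<^sub>2 (\<phi> \<circ> forget_decorations)"
proof -
  note F = linear_dgraph_maps(5)
  have lin\<phi>: "Vector_Spaces.linear pm_scale smult \<phi>" using \<phi> by (simp add: bialgebra_morphism_def)
  have "tensor_square (\<phi> \<circ> forget_decorations) (coprodD (basis c)) =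
      tensor_square \<phi> (coprod\<^sub>1 (forget_decorations (basis c)))" for c
    by (cases c rule: dgclass_cases) (simp add: coprodD H_GD_basis)
  then have "tensor_square (\<phi> \<circ> forget_decorations) (coprodD x) =
      tensor_square \<phi> (coprod\<^sub>1 (forget_decorations x))" for x
    using linear_eqI[OF Vector_Spaces.linear_compose[OF lin(3) linear_tensor_square]
        Vector_Spaces.linear_compose[OF F Vector_Spaces.linear_compose[OF lin(1) linear_tensor_square]],
        of "\<phi> \<circ> forget_decorations" \<phi> x] by simp
  moreover have "counitD (basis c) = counit\<^sub>1 (forget_decorations (basis c))" for c
    by (cases c rule: dgclass_cases) (simp add: counitD H_GD_basis)
  then have "counitD x = counit\<^sub>1 (forget_decorations x)" for x
    using linear_eqI[OF lin(4) Vector_Spaces.linear_compose[OF F lin(2)], of x] by simp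
  ultimately show ?thesis
    using \<phi> Vector_Spaces.linear_compose[OF F lin\<phi>]
    by (simp add: bialgebra_morphism_def forget_decorations_one forget_decorations_mult)
qed

lemma bialgebra_morphism_Delta_forget:
  fixes \<phi> :: "H_G \<Rightarrow> rat poly"
  assumes "bialgebra_morphism HG_Delta HG_eps coprod\<^sub>2 counit\<^sub>2 \<phi>"
  shows "bialgebra_morphism HGD_Delta HGD_eps coprod\<^sub>2 counit\<^sub>2
    (\<phi> \<circ> (forget_decorations :: 'd H_GD \<Rightarrow> H_G))"
proof (rule bialgebra_morphism_forget_decorations[OF assms linear_graph_maps(1,3) linear_dgraph_maps(1,3)])
  fix G :: "(nat, 'd) dgraph" assume G: "is_graph (fst G)"
  have "forget_decorations (basis (dgraph_class (dinduced G I))) = basis (graph_class (induced (fst G) I))"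
    if "I \<subseteq> verts (fst G)" for I
    using is_graph_induced[OF G that] H_GD_basis(4)[of "dinduced G I"] by (simp add: dinduced_def)
  then show "tensor_square (\<phi> \<circ> forget_decorations) (HGD_Delta (basis (dgraph_class G))) =
      tensor_square \<phi> (HG_Delta (basis (graph_class (fst G))))"
    unfolding H_GD_basis[OF G] H_G_basis[OF G] dgraph_Delta_def graph_Delta_def tensor_square_sum_basis
    by (intro sum.cong) auto
  show "HGD_eps (basis (dgraph_class G)) = HG_eps (basis (graph_class (fst G)))"
    by (simp add: H_GD_basis H_G_basis G)
qed

lemma bialgebra_morphism_delta_forget:
  fixes \<phi> :: "H_G \<Rightarrow> rat poly"
  assumes "bialgebra_morphism HG_delta HG_eps' coprod\<^sub>2 counit\<^sub>2 \<phi>"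
  shows "bialgebra_morphism HGD_delta HGD_eps' coprod\<^sub>2 counit\<^sub>2
    (\<phi> \<circ> (forget_decorations :: 'd::ab_semigroup_add H_GD \<Rightarrow> H_G))"
proof (rule bialgebra_morphism_forget_decorations[OF assms linear_graph_maps(2,4) linear_dgraph_maps(2,4)])
  fix G :: "(nat, 'd) dgraph" assume G: "is_graph (fst G)"
  have "forget_decorations (basis (dgraph_class (dcontract G r))) = basis (graph_class (contract_graph (fst G) r))"
    "forget_decorations (basis (dgraph_class (drestrict G r))) = basis (graph_class (restrict_graph (fst G) r))"
    for r
    using is_graph_contract[OF G] H_GD_basis(4)[of "dcontract G r"]
      is_graph_restrict[OF G] H_GD_basis(4)[of "drestrict G r"]
    by (simp_all add: dcontract_def drestrict_def)
  then show "tensor_square (\<phi> \<circ> forget_decorations) (HGD_delta (basis (dgraph_class G))) =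
      tensor_square \<phi> (HG_delta (basis (graph_class (fst G))))"
    unfolding HGD_delta_basis[OF G] H_G_basis[OF G] dgraph_delta_def graph_delta_def tensor_square_sum_basis
    by simp
  show "HGD_eps' (basis (dgraph_class G)) = HG_eps' (basis (graph_class (fst G)))"
    by (simp add: H_GD_basis H_G_basis G)
qed


section \<open>Uniqueness\<close>

text \<open>
  Evaluate $(\phi\otimes\phi)\Delta(G) = \Delta(\phi(G))$ at the point $(k, 1)$; evaluation at $1$ is
  the counit $\varepsilon'$ of $\mathbf{Q}[X]$.
\<close>

lemma poly_Delta_morphism_Suc:
  fixes \<phi> :: "'d H_GD \<Rightarrow> rat poly" and G :: "(nat, 'd) dgraph"
  assumes \<phi>: "bialgebra_morphism HGD_Delta HGD_eps poly_Delta poly_eps \<phi>"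
    and eps': "\<And>x. poly_eps' (\<phi> x) = HGD_eps' x" and G: "is_graph (fst G)"
  shows "poly (\<phi> (basis (dgraph_class G))) (of_nat (Suc k)) =
    (\<Sum>I\<in>Pow (verts (fst G)). poly (\<phi> (basis (dgraph_class (dinduced G I)))) (of_nat k) *
       HGD_eps' (basis (dgraph_class (dinduced G (verts (fst G) - I)))))"
proof -
  have "poly (\<phi> (basis (dgraph_class G))) (of_nat (Suc k)) =
      eval2 (poly_Delta (\<phi> (basis (dgraph_class G)))) (of_nat k) 1"
    by (simp add: eval2_poly_Delta add.commute)
  also have "poly_Delta (\<phi> (basis (dgraph_class G))) = tensor_square \<phi> (dgraph_Delta G)"
    using \<phi> unfolding bialgebra_morphism_def H_GD_basis(1)[OF G, symmetric] by simp
  finally show ?thesis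
    by (simp add: dgraph_Delta_def tensor_square_sum_basis eval2_sum eval2_poly_tensor
        flip: eps' poly_eps'_def)
qed

text \<open>
  The value of $\phi(G)$ at $0$ is $\varepsilon(G)$, and \<open>poly_Delta_morphism_Suc\<close> expresses the value
  at $k + 1$ by values at $k$ for the induced subgraphs of $G$. By induction on $k$, applied to all graphs
  at once, these data determine $\phi(G)$ at every natural number.
\<close>

lemma bialgebra_morphism_unique:
  fixes \<phi> \<psi> :: "'d H_GD \<Rightarrow> rat poly"
  assumes \<phi>: "bialgebra_morphism HGD_Delta HGD_eps poly_Delta poly_eps \<phi>"
      "\<And>x. poly_eps' (\<phi> x) = HGD_eps' x"
    and \<psi>: "bialgebra_morphism HGD_Delta HGD_eps poly_Delta poly_eps \<psi>"
      "\<And>x. poly_eps' (\<psi> x) = HGD_eps' x"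
  shows "\<phi> = \<psi>"
proof
  fix x
  have *: "poly (\<phi> (basis (dgraph_class G))) (of_nat k) = poly (\<psi> (basis (dgraph_class G))) (of_nat k)"
    if "is_graph (fst G)" for G :: "(nat, 'd) dgraph" and k
    using that
  proof (induction k arbitrary: G)
    case 0
    have "poly_eps (\<phi> y) = HGD_eps y" "poly_eps (\<psi> y) = HGD_eps y" for y
      using \<phi>(1) \<psi>(1) by (simp_all add: bialgebra_morphism_def)
    then show ?case by (simp add: poly_eps_def)
  next
    case (Suc k)
    have "is_graph (fst (dinduced G I))" if "I \<subseteq> verts (fst G)" for I
      using is_graph_induced[OF Suc.prems that] by (simp add: dinduced_def)
    then show ?case
      unfolding poly_Delta_morphism_Suc[OF \<phi> Suc.prems] poly_Delta_morphism_Suc[OF \<psi> Suc.prems]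
      by (intro sum.cong) (auto simp: Suc.IH)
  qed
  have "\<phi> (basis c) = \<psi> (basis c)" for c
    by (cases c rule: dgclass_cases) (auto intro: poly_eqI_of_nat *)
  then show "\<phi> x = \<psi> x"
    using \<phi>(1) \<psi>(1) unfolding bialgebra_morphism_def by (blast intro: linear_eqI)
qed

theorem theorem2p4:
  shows "(bialgebra_morphism HG_Delta HG_eps poly_Delta poly_eps P_chr \<and>
          bialgebra_morphism HG_delta HG_eps' poly_delta poly_eps' P_chr \<and>
          (\<forall>\<phi>\<^sub>1 :: H_G \<Rightarrow> rat poly.
             bialgebra_morphism HG_Delta HG_eps poly_Delta poly_eps \<phi>\<^sub>1 \<and>
             bialgebra_morphism HG_delta HG_eps' poly_delta poly_eps' \<phi>\<^sub>1 \<longrightarrow>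
             \<phi>\<^sub>1 = P_chr)) \<and>
         (let P_chr_D = P_chr \<circ> (forget_decorations :: 'd::ab_semigroup_add H_GD \<Rightarrow> H_G) in
          bialgebra_morphism HGD_Delta HGD_eps poly_Delta poly_eps P_chr_D \<and>
          bialgebra_morphism HGD_delta HGD_eps' poly_delta poly_eps' P_chr_D \<and>
          (\<forall>\<phi>\<^sub>1 :: 'd H_GD \<Rightarrow> rat poly.
             bialgebra_morphism HGD_Delta HGD_eps poly_Delta poly_eps \<phi>\<^sub>1 \<and>
             bialgebra_morphism HGD_delta HGD_eps' poly_delta poly_eps' \<phi>\<^sub>1 \<longrightarrow>
             \<phi>\<^sub>1 = P_chr_D))"
proof -
  note P = bialgebra_morphism_Delta_P_chr bialgebra_morphism_delta_P_chr
  note PD = bialgebra_morphism_Delta_forget[OF P(1)] bialgebra_morphism_delta_forget[OF P(2)]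
  have unique: "\<phi> = P_chr \<circ> forget_decorations"
    if "bialgebra_morphism HGD_Delta HGD_eps poly_Delta poly_eps \<phi>"
      "bialgebra_morphism HGD_delta HGD_eps' poly_delta poly_eps' \<phi>"
    for \<phi> :: "'e::ab_semigroup_add H_GD \<Rightarrow> rat poly"
    using that PD unfolding bialgebra_morphism_def[of HGD_delta]
    by (intro bialgebra_morphism_unique) blast+
  have "\<phi> = P_chr"
    if \<phi>: "bialgebra_morphism HG_Delta HG_eps poly_Delta poly_eps \<phi>"
      "bialgebra_morphism HG_delta HG_eps' poly_delta poly_eps' \<phi>" for \<phi>
  proof
    fix x
    \<comment> \<open>With natural numbers as decorations, every graph is the image of a decorated one.\<close>
    have D: "\<phi> \<circ> (forget_decorations :: nat H_GD \<Rightarrow> H_G) = P_chr \<circ> forget_decorations"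
      using \<phi> by (intro unique bialgebra_morphism_Delta_forget bialgebra_morphism_delta_forget)
    have "\<phi> (basis c) = P_chr (basis c)" for c
    proof -
      obtain G :: "nat graph" where G: "is_graph G" and c: "c = graph_class G" by (rule gclass_cases)
      have "forget_decorations (basis (dgraph_class (G, \<lambda>_. 0 :: nat))) = basis c"
        using H_GD_basis(4)[of "(G, \<lambda>_. 0 :: nat)"] G c by simp
      then show ?thesis using fun_cong[OF D, of "basis (dgraph_class (G, \<lambda>_. 0))"] by simp
    qed
    then show "\<phi> x = P_chr x"
      using \<phi>(1) P(1) unfolding bialgebra_morphism_def by (blast intro: linear_eqI)
  qed
  then show ?thesis using P PD unique unfolding Let_def by blast
qed

end
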